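(* Let $\mathbb{S}^n\subset\mathbb{E}^{n+1}$ be the unit sphere, with local parametrization $\boldsymbol{x}=\boldsymbol{f}(u^1,\ldots,u^n)$, and write $x^i_\alpha=\partial x^i/\partial u^\alpha$. The general Killing vector field and the general valence two Killing tensor field on $\mathbb{S}^n$ have covariant components given respectively by $$K_\alpha = x^i_\alpha K_i,\qquad K_{\alpha\beta}=x^i_\alpha x^j_\beta K_{ij},$$ where $$K_i = 2B_{ij}x^j,\qquad K_{ij}=4C_{ikj\ell}x^kx^\ell,$$ with $B_{ij}$ constants satisfying $B_{(ij)}=0$, and $C_{ijk\ell}$ constants satisfying $C_{(ij)k\ell}=0$, $C_{ijk\ell}=C_{k\ell ij}$, $C_{i[jk\ell]}=0$. That is, every such expression defines a Killing vector (resp. valence two Killing tensor) field on $\mathbb{S}^n$, and every Killing vector (resp. valence two Killing tensor) field on $\mathbb{S}^n$ is of this form.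
   Context: $\mathbb{E}^{n+1}$ is Euclidean space with Cartesian coordinates $x^1,\ldots,x^{n+1}$ and metric $g_{ij}=\mathrm{diag}(1,\ldots,1)$. Latin indices run over $1,\ldots,n+1$ and are raised and lowered with $g_{ij}$; Greek indices run over $1,\ldots,n$; repeated indices are summed. $\mathbb{S}^n=\{\boldsymbol{x}\cdot\boldsymbol{x}=1\}$ carries the pulled-back metric $g_{\alpha\beta}=\boldsymbol{x}_\alpha\cdot\boldsymbol{x}_\beta$, where $\boldsymbol{x}_\alpha=\partial\boldsymbol{x}/\partial u^\alpha$. Round brackets on indices denote symmetrization and square brackets denote skew-symmetrization over the enclosed indices. A Killing tensor of valence $p$ on a (pseudo-)Riemannian manifold is a symmetric tensor field whose covariant components satisfy $K_{(i_1\ldots i_p;i_{p+1})}=0$, where ";" is the Levi-Civita covariant derivative; for $p=1$ it is a Killing vector. *)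

theory Defs
  imports "HOL-Analysis.Analysis"
begin

section \<open>Index symmetrization\<close>

text \<open>Index tuples are lists, so \<open>T [a, b, c]\<close> is the component \<open>T\<^sub>a\<^sub>b\<^sub>c\<close>; \<open>sym_part T is\<close>
  and \<open>skew_part T is\<close> are the components of \<open>T\<close> with round, respectively square, brackets
  around the indices \<open>is\<close>.\<close>

definition sym_part :: "('i list \<Rightarrow> real) \<Rightarrow> 'i list \<Rightarrow> real" where
  "sym_part T is =
     (\<Sum>\<sigma> | \<sigma> permutes {..<length is}. T (permute_list \<sigma> is)) / fact (length is)"

definition skew_part :: "('i list \<Rightarrow> real) \<Rightarrow> 'i list \<Rightarrow> real" where
  "skew_part T is =
     (\<Sum>\<sigma> | \<sigma> permutes {..<length is}. of_int (sign \<sigma>) * T (permute_list \<sigma> is))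
       / fact (length is)"

section \<open>Smooth maps and local parametrizations of the sphere\<close>

definition partial_deriv :: "'n::finite \<Rightarrow> (real^'n \<Rightarrow> 'b::real_normed_vector) \<Rightarrow> real^'n \<Rightarrow> 'b" where
  "partial_deriv \<alpha> f u = frechet_derivative f (at u) (axis \<alpha> 1)"

primrec times_diff_on ::
  "nat \<Rightarrow> 'a::real_normed_vector set \<Rightarrow> ('a \<Rightarrow> 'b::real_normed_vector) \<Rightarrow> bool" where
  "times_diff_on 0 U f \<longleftrightarrow> continuous_on U f"
| "times_diff_on (Suc k) U f \<longleftrightarrow>
     (\<forall>u\<in>U. f differentiable (at u)) \<and>
     (\<forall>v. times_diff_on k U (\<lambda>u. frechet_derivative f (at u) v))"

text \<open>Only meant for open \<open>U\<close>.\<close>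

definition smooth_on ::
  "'a::real_normed_vector set \<Rightarrow> ('a \<Rightarrow> 'b::real_normed_vector) \<Rightarrow> bool" where
  "smooth_on U f \<longleftrightarrow> (\<forall>k. times_diff_on k U f)"

text \<open>The finite type \<open>'n\<close> is the Greek index range, with \<open>n = CARD('n) \<ge> 1\<close>. The Latin index
  range is \<open>'n option\<close>, which has \<open>n + 1\<close> elements, so \<open>real^'n option\<close> is \<open>(n+1)\<close>-dimensional
  Euclidean space and \<open>sphere 0 1\<close> in it is the unit \<open>n\<close>-sphere.

  By equality of dimensions, a smooth injective immersion of an open set of \<open>\<real>\<^sup>n\<close> into the
  \<open>n\<close>-sphere is a diffeomorphism onto an open part of the sphere, i.e. the inverse of a chart.\<close>

definition local_parametrization :: "(real^'n) set \<Rightarrow> (real^'n \<Rightarrow> real^('n::finite) option) \<Rightarrow> bool" where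
  "local_parametrization U f \<longleftrightarrow>
     open U \<and> smooth_on U f \<and> f ` U \<subseteq> sphere 0 1 \<and> inj_on f U \<and>
     (\<forall>u\<in>U. inj (frechet_derivative f (at u)))"

section \<open>Pulled-back metric and Levi-Civita derivative\<close>

definition pullback_metric :: "(real^'n \<Rightarrow> real^('n::finite) option) \<Rightarrow> real^'n \<Rightarrow> real^'n^'n" where
  "pullback_metric f u = (\<chi> \<alpha> \<beta>. partial_deriv \<alpha> f u \<bullet> partial_deriv \<beta> f u)"

text \<open>\<open>christoffel f \<gamma> \<alpha> \<beta> u\<close> has upper index \<open>\<gamma>\<close> and lower indices \<open>\<alpha>\<close>, \<open>\<beta>\<close>.\<close>

definition christoffel ::
  "(real^'n \<Rightarrow> real^('n::finite) option) \<Rightarrow> 'n \<Rightarrow> 'n \<Rightarrow> 'n \<Rightarrow> real^'n \<Rightarrow> real" where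
  "christoffel f \<gamma> \<alpha> \<beta> u =
     (\<Sum>\<delta>\<in>UNIV. matrix_inv (pullback_metric f u) $ \<gamma> $ \<delta> *
        (partial_deriv \<alpha> (\<lambda>w. pullback_metric f w $ \<delta> $ \<beta>) u
       + partial_deriv \<beta> (\<lambda>w. pullback_metric f w $ \<delta> $ \<alpha>) u
       - partial_deriv \<delta> (\<lambda>w. pullback_metric f w $ \<alpha> $ \<beta>) u)) / 2"

text \<open>\<open>T is\<close> is the component function of a covariant tensor with indices \<open>is\<close>, and
  \<open>cov_deriv f T is \<gamma> u\<close> is its component \<open>T\<^sub>i\<^sub>s\<^sub>;\<^sub>\<gamma>\<close> at \<open>u\<close>.\<close>

definition cov_deriv ::
  "(real^'n \<Rightarrow> real^('n::finite) option) \<Rightarrow> ('n list \<Rightarrow> real^'n \<Rightarrow> real) \<Rightarrow>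
   'n list \<Rightarrow> 'n \<Rightarrow> real^'n \<Rightarrow> real" where
  "cov_deriv f T is \<gamma> u =
     partial_deriv \<gamma> (T is) u
     - (\<Sum>k<length is. \<Sum>\<delta>\<in>UNIV. christoffel f \<delta> (is ! k) \<gamma> u * T (is[k := \<delta>]) u)"

section \<open>Tensor fields and Killing tensor fields on the sphere\<close>

text \<open>A covariant tensor field \<open>K\<close> of valence \<open>p\<close> on the sphere assigns to each point \<open>x\<close> a
  \<open>p\<close>-linear form \<open>K x\<close> on the tangent space at \<open>x\<close>, taking its arguments as a list of length
  \<open>p\<close>. Values of \<open>K\<close> at other points or on other lists are irrelevant.\<close>

type_synonym 'n ambient_field = "real^'n option \<Rightarrow> (real^'n option) list \<Rightarrow> real"

definition sphere_tangent_space :: "'a::real_inner \<Rightarrow> 'a set" where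
  "sphere_tangent_space x = {v. x \<bullet> v = 0}"

definition coord_components ::
  "'n::finite ambient_field \<Rightarrow> (real^'n \<Rightarrow> real^'n option) \<Rightarrow> 'n list \<Rightarrow> real^'n \<Rightarrow> real" where
  "coord_components K f is u = K (f u) (map (\<lambda>\<alpha>. partial_deriv \<alpha> f u) is)"

definition tensor_field :: "nat \<Rightarrow> 'n::finite ambient_field \<Rightarrow> bool" where
  "tensor_field p K \<longleftrightarrow>
     (\<forall>x\<in>sphere 0 1. \<forall>vs. length vs = p \<longrightarrow> set vs \<subseteq> sphere_tangent_space x \<longrightarrow>
        (\<forall>k<p. \<forall>v\<in>sphere_tangent_space x. \<forall>w\<in>sphere_tangent_space x. \<forall>a b.
           K x (vs[k := a *\<^sub>R v + b *\<^sub>R w]) = a * K x (vs[k := v]) + b * K x (vs[k := w]))) \<and>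
     (\<forall>U f. local_parametrization U f \<longrightarrow>
        (\<forall>is. length is = p \<longrightarrow> smooth_on U (coord_components K f is)))"

definition symmetric_field :: "nat \<Rightarrow> 'n::finite ambient_field \<Rightarrow> bool" where
  "symmetric_field p K \<longleftrightarrow>
     (\<forall>x\<in>sphere 0 1. \<forall>vs. length vs = p \<longrightarrow> set vs \<subseteq> sphere_tangent_space x \<longrightarrow>
        (\<forall>\<sigma>. \<sigma> permutes {..<p} \<longrightarrow> K x (permute_list \<sigma> vs) = K x vs))"

definition killing_tensor_field :: "nat \<Rightarrow> 'n::finite ambient_field \<Rightarrow> bool" where
  "killing_tensor_field p K \<longleftrightarrow>
     tensor_field p K \<and> symmetric_field p K \<and>
     (\<forall>U f. local_parametrization U f \<longrightarrow>
        (\<forall>u\<in>U. \<forall>is. length is = Suc p \<longrightarrow>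
           sym_part (\<lambda>js. cov_deriv f (coord_components K f) (butlast js) (last js) u) is = 0))"

text \<open>Killing vector fields are represented by their covariant components.\<close>

abbreviation killing_vector_field :: "'n::finite ambient_field \<Rightarrow> bool" where
  "killing_vector_field \<equiv> killing_tensor_field 1"

section \<open>The coefficient tensors\<close>

definition vector_constants :: "('m \<Rightarrow> 'm \<Rightarrow> real) \<Rightarrow> bool" where
  "vector_constants B \<longleftrightarrow> (\<forall>i j. sym_part (\<lambda>is. B (is ! 0) (is ! 1)) [i, j] = 0)"

definition tensor_constants :: "('m \<Rightarrow> 'm \<Rightarrow> 'm \<Rightarrow> 'm \<Rightarrow> real) \<Rightarrow> bool" where
  "tensor_constants C \<longleftrightarrow>
     (\<forall>i j k l. sym_part (\<lambda>is. C (is ! 0) (is ! 1) k l) [i, j] = 0) \<and>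
     (\<forall>i j k l. C i j k l = C k l i j) \<and>
     (\<forall>i j k l. skew_part (\<lambda>is. C i (is ! 0) (is ! 1) (is ! 2)) [j, k, l] = 0)"

definition vector_coeff :: "('m::finite \<Rightarrow> 'm \<Rightarrow> real) \<Rightarrow> 'm \<Rightarrow> real^'m \<Rightarrow> real" where
  "vector_coeff B i x = (\<Sum>j\<in>UNIV. 2 * B i j * x $ j)"

definition tensor_coeff ::
  "('m::finite \<Rightarrow> 'm \<Rightarrow> 'm \<Rightarrow> 'm \<Rightarrow> real) \<Rightarrow> 'm \<Rightarrow> 'm \<Rightarrow> real^'m \<Rightarrow> real" where
  "tensor_coeff C i j x = (\<Sum>k\<in>UNIV. \<Sum>l\<in>UNIV. 4 * C i k j l * x $ k * x $ l)"

end

theory Submission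
  imports Defs
begin

text \<open>Sufficiency is a computation. By the Gauss formula, the covariant derivative of \<open>f\<^sub>\<alpha>\<close> is a
  multiple of the position vector \<open>f\<close>, and the skew symmetries of the constants kill every term in
  which such a multiple appears, as well as the symmetrization of what remains.

  For necessity, \<open>K x (v, \<dots>, v)\<close> is constant along great circles. Hence
  \<open>F x v = \<bar>x\<bar>\<^sup>p K (x/\<bar>x\<bar>) (v\<^sub>\<bottom>, \<dots>, v\<^sub>\<bottom>)\<close>, with \<open>v\<^sub>\<bottom>\<close> the part of \<open>v\<close> orthogonal to \<open>x\<close>, satisfies
  \<open>F v x = (-1)\<^sup>p F x v\<close>: a quarter turn along the great circle through \<open>x\<close> in direction \<open>v\<close> exchanges
  the two vectors up to sign. Since \<open>F\<close> is a form of degree \<open>p\<close> in \<open>v\<close>, it is also one in \<open>x\<close>, so for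
  \<open>p = 1\<close> it is an alternating bilinear form, and for \<open>p = 2\<close> a biquadratic form that determines an
  algebraic curvature tensor in the way sectional curvatures do.\<close>

section \<open>Smooth maps\<close>

text \<open>The Killing equation controls only a symmetrized derivative, so necessity reads it with
  all indices equal, and only at the center of a chart whose Christoffel symbols vanish there.
  Restarting a great circle at each of its points spreads the result along the circle.

  The weight \<open>norm x ^ p\<close> is forced by the exchange of \<open>x\<close> and
  \<open>v\<close>: the degree in the base point has to match the degree in the vector. Polynomial
  dependence on the base point then comes from that exchange alone, so no differential equations for
  the components have to be integrated.

  For \<open>p = 1\<close> the exchange carries linearity directly from one argument to the other.
  For \<open>p = 2\<close> it is known only when both vector arguments coincide, and polarizing in
  both the base point and the vectors turns it into the pair symmetry of a 4-linear form. Only then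
  is linearity in the base point slots available.\<close>

lemma frechet_derivative_cong_open:
  assumes "open U" "u \<in> U" "\<And>w. w \<in> U \<Longrightarrow> f w = g w"
  shows "frechet_derivative f (at u) = frechet_derivative g (at u)"
proof -
  \<comment> \<open>\<open>frechet_derivative\<close> is a choice among all derivatives at the
    point; equal sets of candidates give equal choices.\<close>
  have "(f has_derivative D) (at u) \<longleftrightarrow> (g has_derivative D) (at u)" for D
    using assms by (metis has_derivative_transform_within_open)
  then show ?thesis
    by (simp add: frechet_derivative_def)
qed

lemma times_diff_on_cong:
  assumes "open U" "\<And>u. u \<in> U \<Longrightarrow> f u = g u"
  shows "times_diff_on k U f \<longleftrightarrow> times_diff_on k U g"
  using assms(2)
proof (induction k arbitrary: f g)
  case 0
  then show ?case by (simp cong: continuous_on_cong)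
next
  case (Suc k)
  have "f differentiable (at u) \<longleftrightarrow> g differentiable (at u)" if "u \<in> U" for u
    using assms(1) that Suc.prems unfolding differentiable_def
    by (metis has_derivative_transform_within_open)
  moreover have "times_diff_on k U (\<lambda>u. frechet_derivative f (at u) v) \<longleftrightarrow>
      times_diff_on k U (\<lambda>u. frechet_derivative g (at u) v)" for v
    using assms(1) Suc.prems by (intro Suc.IH) (metis frechet_derivative_cong_open)
  ultimately show ?case by simp
qed

text \<open>The induction step of the smoothness proofs: an explicit formula for the derivative,
  known on \<open>U\<close>, takes the place of the chosen
  \<open>frechet_derivative\<close>.\<close>

lemma times_diff_on_SucI:
  assumes "open U" "\<And>u. u \<in> U \<Longrightarrow> (f has_derivative f' u) (at u)"
    and "\<And>v. times_diff_on k U (\<lambda>u. f' u v)"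
  shows "times_diff_on (Suc k) U f"
proof -
  have "frechet_derivative f (at u) = f' u" if "u \<in> U" for u
    using assms(2)[OF that] by (rule frechet_derivative_at[symmetric])
  then have "times_diff_on k U (\<lambda>u. frechet_derivative f (at u) v)" for v
    using assms(3)[of v] by (subst times_diff_on_cong[OF assms(1), where g = "\<lambda>u. f' u v"]) auto
  then show ?thesis
    using assms(2) by (auto simp: differentiable_def)
qed

lemma times_diff_on_SucD: "times_diff_on (Suc k) U f \<Longrightarrow> times_diff_on k U f"
proof (induction k arbitrary: f)
  case 0
  then show ?case
    by (auto intro!: continuous_at_imp_continuous_on differentiable_imp_continuous_within)
next
  case (Suc k)
  then show ?case by (metis times_diff_on.simps(2))
qed

lemma times_diff_on_has_derivative:
  "times_diff_on (Suc k) U f \<Longrightarrow> u \<in> U \<Longrightarrow>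
    (f has_derivative frechet_derivative f (at u)) (at u)"
  by (simp add: frechet_derivative_works[symmetric])

lemma times_diff_on_const: "open U \<Longrightarrow> times_diff_on k U (\<lambda>_. c)"
proof (induction k arbitrary: c)
  case (Suc k)
  show ?case
    by (rule times_diff_on_SucI[where f' = "\<lambda>_ _. 0"]) (use Suc in simp_all)
qed simp

lemma times_diff_on_bounded_linear_compose:
  assumes "open U" "bounded_linear L"
  shows "times_diff_on k U f \<Longrightarrow> times_diff_on k U (\<lambda>u. L (f u))"
proof (induction k arbitrary: f)
  case 0
  then show ?case
    using bounded_linear.continuous_on[OF assms(2)] by auto
next
  case (Suc k)
  show ?case
  proof (rule times_diff_on_SucI[OF assms(1)])
    show "((\<lambda>u. L (f u)) has_derivative (\<lambda>v. L (frechet_derivative f (at u) v))) (at u)"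
      if "u \<in> U" for u
      using times_diff_on_has_derivative[OF Suc.prems that]
      by (rule bounded_linear.has_derivative[OF assms(2)])
    show "times_diff_on k U (\<lambda>u. L (frechet_derivative f (at u) v))" for v
      using Suc by simp
  qed
qed

lemma times_diff_on_bounded_linear:
  assumes "open U" "bounded_linear L"
  shows "times_diff_on k U L"
proof (cases k)
  case 0
  then show ?thesis
    using bounded_linear.continuous_on[OF assms(2) continuous_on_id] by auto
next
  case (Suc k')
  show ?thesis
    unfolding Suc by (rule times_diff_on_SucI[where f' = "\<lambda>_. L"])
      (use assms in \<open>simp_all add: times_diff_on_const bounded_linear_imp_has_derivative\<close>)
qed

lemma times_diff_on_add:
  assumes "open U"
  shows "times_diff_on k U f \<Longrightarrow> times_diff_on k U g \<Longrightarrow> times_diff_on k U (\<lambda>u. f u + g u)"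
proof (induction k arbitrary: f g)
  case 0
  then show ?case by (auto intro: continuous_on_add)
next
  case (Suc k)
  show ?case
  proof (rule times_diff_on_SucI[OF assms])
    show "((\<lambda>u. f u + g u) has_derivative
        (\<lambda>v. frechet_derivative f (at u) v + frechet_derivative g (at u) v)) (at u)"
      if "u \<in> U" for u
      using Suc.prems that by (intro has_derivative_add times_diff_on_has_derivative)
    show "times_diff_on k U (\<lambda>u. frechet_derivative f (at u) v + frechet_derivative g (at u) v)" for v
      using Suc by simp
  qed
qed

lemma times_diff_on_bilinear:
  assumes "open U" "bounded_bilinear B"
  shows "times_diff_on k U f \<Longrightarrow> times_diff_on k U g \<Longrightarrow> times_diff_on k U (\<lambda>u. B (f u) (g u))"
proof (induction k arbitrary: f g)
  case 0
  then show ?case using bounded_bilinear.continuous_on[OF assms(2)] by auto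
next
  case (Suc k)
  show ?case
  proof (rule times_diff_on_SucI[OF assms(1)])
    show "((\<lambda>u. B (f u) (g u)) has_derivative
        (\<lambda>v. B (f u) (frechet_derivative g (at u) v) + B (frechet_derivative f (at u) v) (g u))) (at u)"
      if "u \<in> U" for u
      using Suc.prems that
      by (intro bounded_bilinear.FDERIV[OF assms(2)] times_diff_on_has_derivative)
    \<comment> \<open>Each Leibniz term keeps one factor undifferentiated, so \<open>f\<close> and
      \<open>g\<close> are also needed at the lower order \<open>k\<close>.\<close>
    show "times_diff_on k U (\<lambda>u. B (f u) (frechet_derivative g (at u) v)
        + B (frechet_derivative f (at u) v) (g u))" for v
      using Suc.prems times_diff_on_SucD[OF Suc.prems(1)] times_diff_on_SucD[OF Suc.prems(2)]
      by (intro times_diff_on_add[OF assms(1)] Suc.IH) auto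
  qed
qed

lemma smooth_on_add:
  "open U \<Longrightarrow> smooth_on U f \<Longrightarrow> smooth_on U g \<Longrightarrow> smooth_on U (\<lambda>u. f u + g u)"
  unfolding smooth_on_def by (blast intro: times_diff_on_add)

lemma smooth_on_bilinear:
  "open U \<Longrightarrow> bounded_bilinear B \<Longrightarrow> smooth_on U f \<Longrightarrow> smooth_on U g \<Longrightarrow>
    smooth_on U (\<lambda>u. B (f u) (g u))"
  unfolding smooth_on_def by (blast intro: times_diff_on_bilinear)

lemmas smooth_on_mult = smooth_on_bilinear[OF _ bounded_bilinear_mult]

lemma smooth_on_bounded_linear: "open U \<Longrightarrow> bounded_linear L \<Longrightarrow> smooth_on U L"
  unfolding smooth_on_def by (blast intro: times_diff_on_bounded_linear)

lemma smooth_on_bounded_linear_compose: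
  "open U \<Longrightarrow> bounded_linear L \<Longrightarrow> smooth_on U f \<Longrightarrow> smooth_on U (\<lambda>u. L (f u))"
  unfolding smooth_on_def by (blast intro: times_diff_on_bounded_linear_compose)

lemma smooth_on_frechet_derivative:
  "smooth_on U f \<Longrightarrow> smooth_on U (\<lambda>u. frechet_derivative f (at u) v)"
  unfolding smooth_on_def by (metis times_diff_on.simps(2))

lemma smooth_on_partial_deriv: "smooth_on U f \<Longrightarrow> smooth_on U (partial_deriv \<alpha> f)"
  using smooth_on_frechet_derivative by (simp add: partial_deriv_def [abs_def])

lemma smooth_on_has_derivative:
  "smooth_on U f \<Longrightarrow> u \<in> U \<Longrightarrow> (f has_derivative frechet_derivative f (at u)) (at u)"
  unfolding smooth_on_def by (blast intro: times_diff_on_has_derivative)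

lemma smooth_on_continuous: "smooth_on U f \<Longrightarrow> continuous_on U f"
  unfolding smooth_on_def by (metis times_diff_on.simps(1))

section \<open>Rules for partial derivatives and their commutation\<close>

lemma partial_deriv_eqI:
  "(f has_derivative f') (at u) \<Longrightarrow> partial_deriv \<alpha> f u = f' (axis \<alpha> 1)"
  using frechet_derivative_at[of f f' u] by (simp add: partial_deriv_def)

lemma partial_deriv_cong_open:
  assumes "open U" "u \<in> U" "\<And>w. w \<in> U \<Longrightarrow> f w = g w"
  shows "partial_deriv \<alpha> f u = partial_deriv \<alpha> g u"
  unfolding partial_deriv_def by (simp add: frechet_derivative_cong_open[OF assms])

lemma partial_deriv_bilinear:
  assumes "bounded_bilinear B" "smooth_on U f" "smooth_on U g" "u \<in> U"
  shows "partial_deriv \<alpha> (\<lambda>w. B (f w) (g w)) u =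
    B (f u) (partial_deriv \<alpha> g u) + B (partial_deriv \<alpha> f u) (g u)"
  using partial_deriv_eqI[OF bounded_bilinear.FDERIV[OF assms(1)
        smooth_on_has_derivative[OF assms(2,4)] smooth_on_has_derivative[OF assms(3,4)]]]
  by (simp add: partial_deriv_def)

lemma partial_deriv_bounded_linear:
  assumes "bounded_linear L" "smooth_on U f" "u \<in> U"
  shows "partial_deriv \<alpha> (\<lambda>w. L (f w)) u = L (partial_deriv \<alpha> f u)"
  using partial_deriv_eqI[OF bounded_linear.has_derivative[OF assms(1)
        smooth_on_has_derivative[OF assms(2,3)]]]
  by (simp add: partial_deriv_def)

text \<open>The mean value theorem is applied twice to the alternating sum over the corners of a
  parallelogram, once along each side. That sum does not depend on the order of \<open>v\<close> and
  \<open>w\<close>.\<close>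

lemma second_difference_mean_value:
  fixes f :: "'a::real_normed_vector \<Rightarrow> real"
  assumes "smooth_on U f" "s > 0"
    and U: "\<And>a b. 0 \<le> a \<Longrightarrow> a \<le> s \<Longrightarrow> 0 \<le> b \<Longrightarrow> b \<le> s \<Longrightarrow> x + a *\<^sub>R v + b *\<^sub>R w \<in> U"
  obtains a b where "0 < a" "a < s" "0 < b" "b < s"
    "f (x + s *\<^sub>R v + s *\<^sub>R w) - f (x + s *\<^sub>R v) - f (x + s *\<^sub>R w) + f x =
     s\<^sup>2 * frechet_derivative (\<lambda>y. frechet_derivative f (at y) v) (at (x + a *\<^sub>R v + b *\<^sub>R w)) w"
proof -
  define fv where "fv y = frechet_derivative f (at y) v" for y
  have sfv: "smooth_on U fv"
    unfolding fv_def by (intro smooth_on_frechet_derivative assms)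
  have d1: "((\<lambda>a. f (x + a *\<^sub>R v + b *\<^sub>R w)) has_real_derivative fv (x + a *\<^sub>R v + b *\<^sub>R w)) (at a)"
    if "0 \<le> a" "a \<le> s" "0 \<le> b" "b \<le> s" for a b
  proof -
    let ?D = "frechet_derivative f (at (x + a *\<^sub>R v + b *\<^sub>R w))"
    have D: "(f has_derivative ?D) (at (x + a *\<^sub>R v + b *\<^sub>R w))"
      using smooth_on_has_derivative assms(1) U that by blast
    have "((\<lambda>a. x + a *\<^sub>R v + b *\<^sub>R w) has_derivative (\<lambda>h. h *\<^sub>R v)) (at a)"
      by (auto intro!: derivative_eq_intros)
    from has_derivative_compose[OF this D]
    show ?thesis
      using linear_cmul[OF has_derivative_linear[OF D]]
      by (simp add: has_field_derivative_def fv_def mult.commute[of _ "?D v"] o_def)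
  qed
  have d2: "((\<lambda>b. fv (x + a *\<^sub>R v + b *\<^sub>R w)) has_real_derivative
      frechet_derivative fv (at (x + a *\<^sub>R v + b *\<^sub>R w)) w) (at b)"
    if "0 \<le> a" "a \<le> s" "0 \<le> b" "b \<le> s" for a b
  proof -
    let ?D = "frechet_derivative fv (at (x + a *\<^sub>R v + b *\<^sub>R w))"
    have D: "(fv has_derivative ?D) (at (x + a *\<^sub>R v + b *\<^sub>R w))"
      using smooth_on_has_derivative sfv U that by blast
    have "((\<lambda>b. x + a *\<^sub>R v + b *\<^sub>R w) has_derivative (\<lambda>h. h *\<^sub>R w)) (at b)"
      by (auto intro!: derivative_eq_intros)
    from has_derivative_compose[OF this D]
    show ?thesis
      using linear_cmul[OF has_derivative_linear[OF D]]
      by (simp add: has_field_derivative_def mult.commute[of _ "?D w"] o_def)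
  qed
  \<comment> \<open>The summand \<open>0 *\<^sub>R w\<close> is kept unsimplified so that
    \<open>d1\<close> applies to both terms, with \<open>b = s\<close> and
    \<open>b = 0\<close>.\<close>
  have "\<exists>a>0. a < s \<and> (\<lambda>a. f (x + a *\<^sub>R v + s *\<^sub>R w) - f (x + a *\<^sub>R v + 0 *\<^sub>R w)) s -
      (\<lambda>a. f (x + a *\<^sub>R v + s *\<^sub>R w) - f (x + a *\<^sub>R v + 0 *\<^sub>R w)) 0 =
      (s - 0) * (fv (x + a *\<^sub>R v + s *\<^sub>R w) - fv (x + a *\<^sub>R v + 0 *\<^sub>R w))"
    by (rule MVT2) (use assms(2) in \<open>auto intro!: DERIV_diff d1 simp del: scaleR_zero_left\<close>)
  then obtain a where a: "0 < a" "a < s" and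
    ea: "f (x + s *\<^sub>R v + s *\<^sub>R w) - f (x + s *\<^sub>R v) - (f (x + s *\<^sub>R w) - f x) =
      s * (fv (x + a *\<^sub>R v + s *\<^sub>R w) - fv (x + a *\<^sub>R v))"
    by auto
  have "\<exists>b>0. b < s \<and> fv (x + a *\<^sub>R v + s *\<^sub>R w) - fv (x + a *\<^sub>R v + 0 *\<^sub>R w) =
      (s - 0) * frechet_derivative fv (at (x + a *\<^sub>R v + b *\<^sub>R w)) w"
    by (rule MVT2) (use assms(2) a in \<open>auto intro!: d2 simp del: scaleR_zero_left\<close>)
  then obtain b where "0 < b" "b < s" and
    "fv (x + a *\<^sub>R v + s *\<^sub>R w) - fv (x + a *\<^sub>R v) =
      s * frechet_derivative fv (at (x + a *\<^sub>R v + b *\<^sub>R w)) w"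
    by auto
  with a ea show ?thesis
    by (intro that[of a b]) (simp_all add: power2_eq_square fv_def [abs_def] algebra_simps)
qed

text \<open>Both mixed derivatives represent the same second difference, so they take a common value
  at points arbitrarily close to \<open>x\<close>; continuity excludes a gap at
  \<open>x\<close>.\<close>

lemma second_frechet_derivative_commute:
  fixes f :: "'a::real_normed_vector \<Rightarrow> real"
  assumes f: "smooth_on U f" and U: "open U" "x \<in> U"
  shows "frechet_derivative (\<lambda>y. frechet_derivative f (at y) v) (at x) w =
    frechet_derivative (\<lambda>y. frechet_derivative f (at y) w) (at x) v" (is "?g x = ?h x")
proof (rule ccontr)
  assume ne: "?g x \<noteq> ?h x"
  \<comment> \<open>Half the gap: values closer than \<open>e\<close> to the two different limits
    cannot coincide.\<close>
  define e where "e = \<bar>?g x - ?h x\<bar> / 2"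
  have "e > 0" using ne by (simp add: e_def)
  have "continuous_on U ?g" "continuous_on U ?h"
    by (intro smooth_on_continuous smooth_on_frechet_derivative f)+
  then have "isCont ?g x" "isCont ?h x"
    using U by (simp_all add: continuous_on_eq_continuous_at)
  then have "(?g \<longlongrightarrow> ?g x) (nhds x)" "(?h \<longlongrightarrow> ?h x) (nhds x)"
    using tendsto_at_iff_tendsto_nhds[of ?g x] tendsto_at_iff_tendsto_nhds[of ?h x]
    by (simp_all add: isCont_def)
  then have "\<forall>\<^sub>F y in nhds x. y \<in> U \<and> dist (?g y) (?g x) < e \<and> dist (?h y) (?h x) < e"
    using \<open>e > 0\<close> U unfolding tendsto_iff
    by (intro eventually_conj eventually_nhds_in_open) auto
  then obtain d where "d > 0"
    and d: "\<And>y. dist y x < d \<Longrightarrow> y \<in> U \<and> dist (?g y) (?g x) < e \<and> dist (?h y) (?h x) < e"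
    unfolding eventually_nhds_metric by blast
  \<comment> \<open>Small enough for the whole parallelogram to lie within distance \<open>d\<close>
    of \<open>x\<close>; the summand 1 keeps the denominator positive.\<close>
  define s where "s = d / (norm v + norm w + 1)"
  have pos: "norm v + norm w + 1 > 0"
    by (simp add: add_nonneg_pos)
  have "s > 0" using \<open>d > 0\<close> pos by (simp add: s_def)
  have small: "dist (x + a *\<^sub>R v + b *\<^sub>R w) x < d" if "0 \<le> a" "a \<le> s" "0 \<le> b" "b \<le> s" for a b
  proof -
    have "norm (a *\<^sub>R v + b *\<^sub>R w) \<le> a * norm v + b * norm w"
      using that norm_triangle_ineq[of "a *\<^sub>R v" "b *\<^sub>R w"] by simp
    also have "\<dots> \<le> s * norm v + s * norm w"
      using that by (intro add_mono mult_right_mono) auto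
    also have "\<dots> < s * (norm v + norm w + 1)"
      using \<open>s > 0\<close> by (simp add: algebra_simps)
    also have "\<dots> = d" using pos by (simp add: s_def)
    finally show ?thesis by (simp add: dist_norm add.assoc)
  qed
  have inU: "x + a *\<^sub>R v + b *\<^sub>R w \<in> U" if "0 \<le> a" "a \<le> s" "0 \<le> b" "b \<le> s" for a b
    using d small[OF that] by blast
  have inU': "x + a *\<^sub>R w + b *\<^sub>R v \<in> U" if "0 \<le> a" "a \<le> s" "0 \<le> b" "b \<le> s" for a b
    using inU[OF that(3,4,1,2)] by (metis add.assoc add.commute)
  obtain a b where ab: "0 < a" "a < s" "0 < b" "b < s"
    "f (x + s *\<^sub>R v + s *\<^sub>R w) - f (x + s *\<^sub>R v) - f (x + s *\<^sub>R w) + f x =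
     s\<^sup>2 * ?g (x + a *\<^sub>R v + b *\<^sub>R w)"
    by (rule second_difference_mean_value[OF f \<open>s > 0\<close>]) (use inU in auto)
  obtain a' b' where ab': "0 < a'" "a' < s" "0 < b'" "b' < s"
    "f (x + s *\<^sub>R w + s *\<^sub>R v) - f (x + s *\<^sub>R w) - f (x + s *\<^sub>R v) + f x =
     s\<^sup>2 * ?h (x + a' *\<^sub>R w + b' *\<^sub>R v)"
    by (rule second_difference_mean_value[OF f \<open>s > 0\<close>]) (use inU' in auto)
  have "x + s *\<^sub>R w + s *\<^sub>R v = x + s *\<^sub>R v + s *\<^sub>R w" "x + a' *\<^sub>R w + b' *\<^sub>R v = x + b' *\<^sub>R v + a' *\<^sub>R w"
    by simp_all
  with ab(5) ab'(5)
  have "s\<^sup>2 * ?g (x + a *\<^sub>R v + b *\<^sub>R w) = s\<^sup>2 * ?h (x + b' *\<^sub>R v + a' *\<^sub>R w)"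
    by (simp only:)
  then have "?g (x + a *\<^sub>R v + b *\<^sub>R w) = ?h (x + b' *\<^sub>R v + a' *\<^sub>R w)"
    using \<open>s > 0\<close> by simp
  moreover have "dist (?g (x + a *\<^sub>R v + b *\<^sub>R w)) (?g x) < e"
    "dist (?h (x + b' *\<^sub>R v + a' *\<^sub>R w)) (?h x) < e"
    using d small ab ab' by simp_all
  ultimately show False
    by (simp add: e_def dist_real_def abs_if split: if_splits)
qed

text \<open>The mean value argument is scalar, so the vector-valued case is tested against every
  vector \<open>e\<close>.\<close>

lemma partial_deriv_commute:
  fixes f :: "real^'n \<Rightarrow> 'b::real_inner"
  assumes f: "smooth_on U f" and U: "open U" "u \<in> U"
  shows "partial_deriv \<alpha> (partial_deriv \<beta> f) u = partial_deriv \<beta> (partial_deriv \<alpha> f) u"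
proof -
  have "partial_deriv \<alpha> (partial_deriv \<beta> f) u \<bullet> e = partial_deriv \<beta> (partial_deriv \<alpha> f) u \<bullet> e" for e
  proof -
    note bl = bounded_linear_inner_left[of e]
    have sf: "smooth_on U (\<lambda>w. f w \<bullet> e)"
      using smooth_on_bounded_linear_compose[OF U(1) bl f] .
    have *: "partial_deriv \<alpha> (partial_deriv \<beta> f) u \<bullet> e =
        partial_deriv \<alpha> (partial_deriv \<beta> (\<lambda>w. f w \<bullet> e)) u" for \<alpha> \<beta>
    proof -
      have "partial_deriv \<alpha> (partial_deriv \<beta> f) u \<bullet> e =
          partial_deriv \<alpha> (\<lambda>w. partial_deriv \<beta> f w \<bullet> e) u"
        using partial_deriv_bounded_linear[OF bl smooth_on_partial_deriv[OF f] U(2)] by simp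
      also have "\<dots> = partial_deriv \<alpha> (partial_deriv \<beta> (\<lambda>w. f w \<bullet> e)) u"
        using partial_deriv_bounded_linear[OF bl f]
        by (intro partial_deriv_cong_open[OF U]) simp
      finally show ?thesis .
    qed
    show ?thesis
      unfolding * using second_frechet_derivative_commute[OF sf U]
      by (simp add: partial_deriv_def [abs_def])
  qed
  then show ?thesis
    by (metis inner_commute vector_eq_ldot)
qed

section \<open>Index symmetrization\<close>

lemma sum_permutations_2:
  "(\<Sum>\<sigma> | \<sigma> permutes {..<2::nat}. F \<sigma>) = F id + F (Transposition.transpose 0 1)"
proof -
  have "{..<2::nat} = {0, 1}" by auto
  moreover have "Transposition.transpose 0 1 \<noteq> (id :: nat \<Rightarrow> nat)"
    by (metis id_apply transpose_apply_first zero_neq_one)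
  ultimately show ?thesis
    by (simp add: permutes_doubleton_iff Collect_disj_eq add.commute)
qed

lemma sym_part_2: "sym_part T [a, b] = (T [a, b] + T [b, a]) / 2"
  using sum_permutations_2[of "\<lambda>\<sigma>. T (permute_list \<sigma> [a, b])"]
  by (simp add: sym_part_def permute_list_def numeral_2_eq_2)

lemma upt_3: "[0..<Suc (Suc (Suc 0))] = [0, 1, 2]"
  by (simp add: upt_rec)

text \<open>\<open>F\<close> receives the sign together with the permuted list, so one enumeration
  serves both the round and the square brackets.\<close>

lemma sum_permutations_3:
  "(\<Sum>\<sigma> | \<sigma> permutes {..<3::nat}. F (sign \<sigma>) (permute_list \<sigma> [a, b, c])) =
    F 1 [a, b, c] + F 1 [b, c, a] + F 1 [c, a, b] +
    F (-1) [b, a, c] + F (-1) [a, c, b] + F (-1) [c, b, a]"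
  for F :: "int \<Rightarrow> 'a list \<Rightarrow> real"
proof -
  have lt3: "{..<3::nat} = {0, 1, 2}" by auto
  have f012: "finite {1::nat, 2}" "0 \<notin> {1::nat, 2}"
    by auto
  have f12: "finite {2::nat}" "1 \<notin> {2::nat}"
    by auto
  show ?thesis
    unfolding lt3
    unfolding sum_over_permutations_insert[OF f012]
    unfolding sum_over_permutations_insert[OF f12]
    unfolding permutes_sing
    by (simp add: sign_swap_id permutation_swap_id sign_compose sign_id permute_list_def
        upt_3 Transposition.transpose_def)
qed

lemma sym_part_3:
  "sym_part T [a, b, c] =
    (T [a, b, c] + T [b, c, a] + T [c, a, b] + T [b, a, c] + T [a, c, b] + T [c, b, a]) / 6"
  using sum_permutations_3[of "\<lambda>_. T" a b c]
  by (simp add: sym_part_def numeral_3_eq_3)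

lemma skew_part_3:
  "skew_part T [a, b, c] =
    (T [a, b, c] + T [b, c, a] + T [c, a, b] - T [b, a, c] - T [a, c, b] - T [c, b, a]) / 6"
  using sum_permutations_3[of "\<lambda>s xs. of_int s * T xs" a b c]
  by (simp add: skew_part_def numeral_3_eq_3)

lemma linear_cart_expansion:
  fixes L :: "real^'n \<Rightarrow> 'b::real_vector"
  assumes "linear L"
  shows "L v = (\<Sum>i\<in>UNIV. v $ i *\<^sub>R L (axis i 1))"
proof -
  have "L v = L (\<Sum>i\<in>UNIV. v $ i *\<^sub>R axis i 1)"
    using basis_expansion[of v] by (simp add: scalar_mult_eq_scaleR)
  then show ?thesis
    by (simp add: linear_sum[OF assms] linear_cmul[OF assms])
qed

lemma bounded_bilinear_inner_matrix: "bounded_bilinear (\<lambda>v x. v \<bullet> (A *v x))"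
  for A :: "real^'n^'m"
  by (rule bounded_bilinear.comp[OF bounded_bilinear_inner bounded_linear_ident
        matrix_vector_mul_bounded_linear])

section \<open>The Gauss formula for local parametrizations\<close>

context
  fixes U :: "(real^'n) set" and f :: "real^'n \<Rightarrow> real^('n::finite) option"
  assumes f: "local_parametrization U f"
begin

lemma param_open: "open U"
  and param_smooth: "smooth_on U f"
  and param_derivative_inj: "u \<in> U \<Longrightarrow> inj (frechet_derivative f (at u))"
  and param_unit: "u \<in> U \<Longrightarrow> f u \<bullet> f u = 1"
  using f by (auto simp: local_parametrization_def dot_square_norm)

lemma param_has_derivative: "u \<in> U \<Longrightarrow> (f has_derivative frechet_derivative f (at u)) (at u)"
  using smooth_on_has_derivative[OF param_smooth] .

lemma param_derivative_linear: "u \<in> U \<Longrightarrow> linear (frechet_derivative f (at u))"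
  using has_derivative_linear[OF param_has_derivative] .

lemma param_derivative_expansion:
  "u \<in> U \<Longrightarrow> frechet_derivative f (at u) v = (\<Sum>\<alpha>\<in>UNIV. v $ \<alpha> *\<^sub>R partial_deriv \<alpha> f u)"
  using linear_cart_expansion[OF param_derivative_linear] by (simp add: partial_deriv_def)

lemma param_tangent: assumes "u \<in> U" shows "f u \<bullet> partial_deriv \<alpha> f u = 0"
proof -
  have "partial_deriv \<alpha> (\<lambda>w. f w \<bullet> f w) u = partial_deriv \<alpha> (\<lambda>w. 1) u"
    using param_unit by (intro partial_deriv_cong_open[OF param_open assms]) auto
  also have "\<dots> = 0"
    by (rule partial_deriv_eqI) simp
  finally show ?thesis
    using partial_deriv_bilinear[OF bounded_bilinear_inner param_smooth param_smooth assms]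
    by (simp add: inner_commute)
qed

text \<open>A dimension count: the position vector and the \<open>n\<close> coordinate vectors are
  independent in a space of dimension \<open>n + 1\<close>, so they span it. The map
  \<open>?L\<close> combines them into an endomorphism of that space, for which injectivity gives
  surjectivity.\<close>

lemma param_normal_multiple:
  assumes u: "u \<in> U" and w: "\<And>\<alpha>. w \<bullet> partial_deriv \<alpha> f u = 0"
  shows "w = (w \<bullet> f u) *\<^sub>R f u"
proof -
  let ?D = "frechet_derivative f (at u)"
  let ?L = "\<lambda>y::real^'n option. y $ None *\<^sub>R f u + ?D (\<chi> \<alpha>. y $ Some \<alpha>)"
  note D = param_derivative_linear[OF u]
  have vec: "(\<chi> \<alpha>. (x + y) $ Some \<alpha>) = (\<chi> \<alpha>. x $ Some \<alpha>) + (\<chi> \<alpha>. y $ Some \<alpha>)"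
    "(\<chi> \<alpha>. (c *\<^sub>R x) $ Some \<alpha>) = c *\<^sub>R (\<chi> \<alpha>. x $ Some \<alpha>)" for c and x y :: "real^'n option"
    by (simp_all add: vec_eq_iff)
  have L: "linear ?L"
    by (rule linearI) (simp_all only: vec linear_add[OF D] linear_cmul[OF D],
        simp_all add: algebra_simps)
  have tang: "f u \<bullet> ?D v = 0" for v
    by (simp add: param_derivative_expansion[OF u] inner_sum_right param_tangent[OF u])
  have "inj ?L"
  proof (subst linear_injective_0[OF L], intro allI impI)
    fix y assume y: "?L y = 0"
    then have "f u \<bullet> ?L y = 0" by simp
    then have y0: "y $ None = 0"
      using tang param_unit[OF u] by (simp add: inner_add_right)
    then have "?D (\<chi> \<alpha>. y $ Some \<alpha>) = 0" using y by simp
    then have "(\<chi> \<alpha>. y $ Some \<alpha>) = 0"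
      using param_derivative_inj[OF u] linear_injective_0[OF D] by blast
    then have "y $ Some \<alpha> = 0" for \<alpha> by (simp add: vec_eq_iff)
    with y0 have "y $ i = 0" for i by (cases i) auto
    then show "y = 0" by (simp add: vec_eq_iff)
  qed
  then have "surj ?L" using linear_injective_imp_surjective[OF L] by simp
  define z where "z = w - (w \<bullet> f u) *\<^sub>R f u"
  obtain y where y: "z = ?L y" using surjD[OF \<open>surj ?L\<close>] by blast
  have "z \<bullet> f u = 0"
    by (simp add: z_def inner_diff_left param_unit[OF u])
  moreover have "z \<bullet> ?D v = 0" for v
    using w tang by (simp add: z_def inner_diff_left)
      (simp add: param_derivative_expansion[OF u] inner_sum_right)
  \<comment> \<open>\<open>z\<close> is orthogonal to every value of \<open>?L\<close> and is itself
    such a value.\<close>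
  ultimately have "z \<bullet> z = 0"
    by (subst (2) y) (simp add: inner_add_right)
  then show ?thesis by (simp add: z_def)
qed

text \<open>A kernel vector has an image under the derivative that is orthogonal to all coordinate
  vectors, hence to itself; the immersion property finishes.\<close>

lemma pullback_metric_invertible: assumes u: "u \<in> U" shows "invertible (pullback_metric f u)"
proof -
  let ?D = "frechet_derivative f (at u)"
  have "v = 0" if "pullback_metric f u *v v = 0" for v
  proof -
    have "?D v \<bullet> partial_deriv \<alpha> f u = (pullback_metric f u *v v) $ \<alpha>" for \<alpha>
      by (simp add: param_derivative_expansion[OF u] inner_sum_left pullback_metric_def
          matrix_vector_mult_def inner_commute[of "partial_deriv \<alpha> f u"] mult.commute)
    then have "?D v \<bullet> ?D v = 0"
      using that by (subst (2) param_derivative_expansion[OF u]) (simp add: inner_sum_right)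
    then have "?D v = 0" by simp
    then show ?thesis
      using param_derivative_inj[OF u] linear_injective_0[OF param_derivative_linear[OF u]] by blast
  qed
  then show ?thesis
    using invertible_left_inverse matrix_left_invertible_ker by blast
qed

lemma pullback_metric_deriv:
  assumes "u \<in> U"
  shows "partial_deriv \<gamma> (\<lambda>w. pullback_metric f w $ \<alpha> $ \<beta>) u =
    partial_deriv \<alpha> f u \<bullet> partial_deriv \<gamma> (partial_deriv \<beta> f) u +
    partial_deriv \<gamma> (partial_deriv \<alpha> f) u \<bullet> partial_deriv \<beta> f u"
  using partial_deriv_bilinear[OF bounded_bilinear_inner
      smooth_on_partial_deriv[OF param_smooth] smooth_on_partial_deriv[OF param_smooth] assms]
  by (simp add: pullback_metric_def)

text \<open>Expanding the three metric derivatives gives six products; commuting partial derivatives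
  cancels four of them and makes the other two equal.\<close>

lemma christoffel_eq:
  assumes u: "u \<in> U"
  shows "christoffel f \<gamma> \<alpha> \<beta> u = (\<Sum>\<delta>\<in>UNIV. matrix_inv (pullback_metric f u) $ \<gamma> $ \<delta> *
    (partial_deriv \<alpha> (partial_deriv \<beta> f) u \<bullet> partial_deriv \<delta> f u))"
proof -
  have "partial_deriv \<alpha> (\<lambda>w. pullback_metric f w $ \<delta> $ \<beta>) u
       + partial_deriv \<beta> (\<lambda>w. pullback_metric f w $ \<delta> $ \<alpha>) u
       - partial_deriv \<delta> (\<lambda>w. pullback_metric f w $ \<alpha> $ \<beta>) u =
      2 * (partial_deriv \<alpha> (partial_deriv \<beta> f) u \<bullet> partial_deriv \<delta> f u)" for \<delta>
    using partial_deriv_commute[OF param_smooth param_open u]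
    by (simp add: pullback_metric_deriv[OF u] inner_commute)
  then show ?thesis
    by (simp add: christoffel_def sum_distrib_left mult.left_commute[of _ 2]
        flip: sum_distrib_left)
qed

text \<open>Lowering the upper index cancels the inverse metric. This identifies the Christoffel
  symbols as the coefficients of the tangential part of the second derivative.\<close>

lemma christoffel_contraction:
  assumes u: "u \<in> U"
  shows "(\<Sum>\<delta>\<in>UNIV. christoffel f \<delta> \<alpha> \<beta> u * (partial_deriv \<delta> f u \<bullet> partial_deriv \<epsilon> f u)) =
    partial_deriv \<alpha> (partial_deriv \<beta> f) u \<bullet> partial_deriv \<epsilon> f u"
proof -
  let ?g = "pullback_metric f u" and ?a = "\<lambda>\<eta>. partial_deriv \<alpha> (partial_deriv \<beta> f) u \<bullet> partial_deriv \<eta> f u"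
  have metric: "?g $ \<epsilon> $ \<delta> = partial_deriv \<delta> f u \<bullet> partial_deriv \<epsilon> f u" for \<delta>
    by (simp add: pullback_metric_def inner_commute)
  have inv: "?g ** matrix_inv ?g = mat 1"
    using pullback_metric_invertible[OF u] unfolding invertible_def matrix_inv_def
    by (rule someI2_ex) blast
  have "(\<Sum>\<delta>\<in>UNIV. christoffel f \<delta> \<alpha> \<beta> u * (partial_deriv \<delta> f u \<bullet> partial_deriv \<epsilon> f u)) =
      (\<Sum>\<delta>\<in>UNIV. \<Sum>\<eta>\<in>UNIV. ?a \<eta> * (?g $ \<epsilon> $ \<delta> * matrix_inv ?g $ \<delta> $ \<eta>))"
    unfolding christoffel_eq[OF u] sum_distrib_right
    by (intro sum.cong refl) (simp add: metric mult_ac)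
  also have "\<dots> = (\<Sum>\<eta>\<in>UNIV. ?a \<eta> * (?g ** matrix_inv ?g) $ \<epsilon> $ \<eta>)"
    by (subst sum.swap) (simp add: matrix_matrix_mult_def sum_distrib_left)
  also have "\<dots> = ?a \<epsilon>"
    by (simp add: inv mat_def if_distrib cong: if_cong)
  finally show ?thesis .
qed

text \<open>What remains after removing the tangential part is orthogonal to all coordinate vectors,
  hence a multiple of the position vector. The factor stays unspecified because the forms considered
  below vanish on every such multiple.\<close>

lemma gauss_formula:
  assumes u: "u \<in> U"
  obtains c where "partial_deriv \<gamma> (partial_deriv \<alpha> f) u =
    (\<Sum>\<delta>\<in>UNIV. christoffel f \<delta> \<alpha> \<gamma> u *\<^sub>R partial_deriv \<delta> f u) + c *\<^sub>R f u"
proof -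
  let ?w = "partial_deriv \<gamma> (partial_deriv \<alpha> f) u
    - (\<Sum>\<delta>\<in>UNIV. christoffel f \<delta> \<alpha> \<gamma> u *\<^sub>R partial_deriv \<delta> f u)"
  have "?w \<bullet> partial_deriv \<epsilon> f u = 0" for \<epsilon>
    using christoffel_contraction[OF u, of \<alpha> \<gamma> \<epsilon>]
      partial_deriv_commute[OF param_smooth param_open u, of \<alpha> \<gamma>]
    by (simp add: inner_diff_left inner_sum_left)
  then have "?w = (?w \<bullet> f u) *\<^sub>R f u"
    by (rule param_normal_multiple[OF u])
  then show ?thesis
    by (intro that[of "?w \<bullet> f u"]) (simp add: algebra_simps)
qed

end

section \<open>Killing tensor fields from constants\<close>

lemma vector_constants_iff: "vector_constants B \<longleftrightarrow> (\<forall>i j. B i j = - B j i)"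
  by (simp add: vector_constants_def sym_part_2 eq_neg_iff_add_eq_0)

text \<open>Pair exchange carries skewness from the first pair of indices to the second.\<close>

lemma tensor_constants_skew:
  assumes "tensor_constants C"
  shows "C i j k l = - C j i k l" "C i j k l = - C i j l k"
proof -
  have 0: "sym_part (\<lambda>is. C (is ! 0) (is ! 1) k l) [i, j] = 0"
    and 2: "C i j k l = C k l i j" for i j k l
    using assms unfolding tensor_constants_def by blast+
  have 1: "C i j k l = - C j i k l" for i j k l
    using 0[of k l i j] by (simp add: sym_part_2 eq_neg_iff_add_eq_0)
  show "C i j k l = - C j i k l" by (rule 1)
  show "C i j k l = - C i j l k" using 2[of i j k l] 1[of k l i j] 2[of l k i j] by linarith
qed

text \<open>With skewness in the last pair, odd and even permutations contribute equally, and the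
  bracket over \<open>j k l\<close> becomes the first Bianchi identity. The constants are thus the
  algebraic curvature tensors.\<close>

lemma tensor_constants_iff:
  "tensor_constants C \<longleftrightarrow> (\<forall>i j k l. C i j k l = - C j i k l) \<and> (\<forall>i j k l. C i j k l = C k l i j) \<and>
     (\<forall>i j k l. C i j k l + C i k l j + C i l j k = 0)"
  (is "_ \<longleftrightarrow> ?R")
proof
  assume C: "tensor_constants C"
  have "C i j k l + C i k l j + C i l j k = 0" for i j k l
  proof -
    have "skew_part (\<lambda>is. C i (is ! 0) (is ! 1) (is ! 2)) [j, k, l] = 0"
      using C by (simp add: tensor_constants_def)
    then show ?thesis
      unfolding skew_part_3
      using tensor_constants_skew(2)[OF C, of i k j l] tensor_constants_skew(2)[OF C, of i j l k]
        tensor_constants_skew(2)[OF C, of i l k j]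
      by simp
  qed
  then show ?R
    using C tensor_constants_skew(1)[OF C] unfolding tensor_constants_def by blast
next
  assume ?R
  then have skew: "C i j k l = - C j i k l" and pair: "C i j k l = C k l i j"
    and cyclic: "C i j k l + C i k l j + C i l j k = 0" for i j k l
    by blast+
  \<comment> \<open>The even permutations of \<open>j k l\<close> form one cyclic sum, the odd ones
    another.\<close>
  have "skew_part (\<lambda>is. C i (is ! 0) (is ! 1) (is ! 2)) [j, k, l] = 0" for i j k l
    using cyclic[of i j k l] cyclic[of i k j l] by (simp add: skew_part_3)
  moreover have "sym_part (\<lambda>is. C (is ! 0) (is ! 1) k l) [i, j] = 0" for i j k l
    using skew[of i j k l] by (simp add: sym_part_2)
  ultimately show "tensor_constants C"
    using pair unfolding tensor_constants_def by blast
qed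

lemma cov_deriv_1:
  "cov_deriv f T [\<alpha>] \<gamma> u =
    partial_deriv \<gamma> (T [\<alpha>]) u - (\<Sum>\<delta>\<in>UNIV. christoffel f \<delta> \<alpha> \<gamma> u * T [\<delta>] u)"
  by (simp add: cov_deriv_def)

lemma cov_deriv_2:
  "cov_deriv f T [\<alpha>, \<beta>] \<gamma> u =
    partial_deriv \<gamma> (T [\<alpha>, \<beta>]) u - (\<Sum>\<delta>\<in>UNIV. christoffel f \<delta> \<alpha> \<gamma> u * T [\<delta>, \<beta>] u)
      - (\<Sum>\<delta>\<in>UNIV. christoffel f \<delta> \<beta> \<gamma> u * T [\<alpha>, \<delta>] u)"
  by (simp add: cov_deriv_def)

lemma permutes_2_cases:
  assumes "\<sigma> permutes {..<2::nat}"
  obtains "\<sigma> = id" | "\<sigma> = Transposition.transpose 0 1"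
proof -
  have "{..<2::nat} = {0, 1}" by auto
  then show ?thesis using assms that by (simp add: permutes_doubleton_iff) blast
qed

lemma length_2_cases:
  assumes "length xs = 2" obtains a b where "xs = [a, b]"
  using assms by (auto simp: numeral_2_eq_2 length_Suc_conv)

lemma length_3_cases:
  assumes "length xs = 3" obtains a b c where "xs = [a, b, c]"
  using assms by (auto simp: numeral_3_eq_3 length_Suc_conv)

text \<open>Fields built from constants come from forms on the whole ambient space, so their
  algebraic conditions can be checked on arbitrary vectors.\<close>

lemma killing_tensor_fieldI:
  assumes "\<And>x vs k v w a b. length vs = p \<Longrightarrow> k < p \<Longrightarrow>
      K x (vs[k := a *\<^sub>R v + b *\<^sub>R w]) = a * K x (vs[k := v]) + b * K x (vs[k := w])"
    and "\<And>x vs \<sigma>. length vs = p \<Longrightarrow> \<sigma> permutes {..<p} \<Longrightarrow> K x (permute_list \<sigma> vs) = K x vs"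
    and "\<And>U f is. local_parametrization U f \<Longrightarrow> length is = p \<Longrightarrow>
      smooth_on U (coord_components K f is)"
    and "\<And>U f u is. local_parametrization U f \<Longrightarrow> u \<in> U \<Longrightarrow> length is = Suc p \<Longrightarrow>
      sym_part (\<lambda>js. cov_deriv f (coord_components K f) (butlast js) (last js) u) is = 0"
  shows "killing_tensor_field p K"
  using assms by (simp add: killing_tensor_field_def tensor_field_def symmetric_field_def)

text \<open>By the Gauss formula, differentiating the factor \<open>f\<^sub>\<alpha>\<close> covariantly gives a multiple of
  \<open>f\<close>, on which the form vanishes; only \<open>\<Phi>(f\<^sub>\<alpha>, f\<^sub>\<gamma>)\<close> survives.\<close>

lemma bilinear_killing_vector_field:
  fixes \<Phi> :: "real^'n::finite option \<Rightarrow> real^'n option \<Rightarrow> real"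
  assumes \<Phi>: "bounded_bilinear \<Phi>" and skew: "\<And>x y. \<Phi> x y = - \<Phi> y x"
  shows "killing_vector_field (\<lambda>x vs. \<Phi> (vs ! 0) x)"
proof -
  let ?K = "\<lambda>x vs. \<Phi> (vs ! 0) x"
  interpret \<Phi>: bounded_bilinear \<Phi> by (rule \<Phi>)
  have comp: "coord_components ?K f [\<alpha>] = (\<lambda>u. \<Phi> (partial_deriv \<alpha> f u) (f u))" for f \<alpha>
    by (simp add: coord_components_def fun_eq_iff)
  have "\<Phi> x x = 0" for x using skew[of x x] by simp
  have cov: "cov_deriv f (coord_components ?K f) [\<alpha>] \<gamma> u = \<Phi> (partial_deriv \<alpha> f u) (partial_deriv \<gamma> f u)"
    if f: "local_parametrization U f" and u: "u \<in> U" for U f \<alpha> \<gamma> u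
  proof -
    obtain c where c: "partial_deriv \<gamma> (partial_deriv \<alpha> f) u =
        (\<Sum>\<delta>\<in>UNIV. christoffel f \<delta> \<alpha> \<gamma> u *\<^sub>R partial_deriv \<delta> f u) + c *\<^sub>R f u"
      using gauss_formula[OF f u] .
    show ?thesis
      using partial_deriv_bilinear[OF \<Phi> smooth_on_partial_deriv[OF param_smooth[OF f]]
          param_smooth[OF f] u] \<open>\<And>x. \<Phi> x x = 0\<close>
      by (simp add: cov_deriv_1 comp c \<Phi>.add_left \<Phi>.sum_left \<Phi>.scaleR_left)
  qed
  show ?thesis
  proof (rule killing_tensor_fieldI)
    show "sym_part (\<lambda>js. cov_deriv f (coord_components ?K f) (butlast js) (last js) u) is = 0"
      if f: "local_parametrization U f" and u: "u \<in> U" and "length is = Suc 1" for U f "is" u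
    proof -
      obtain \<alpha> \<gamma> where "is = [\<alpha>, \<gamma>]"
        using \<open>length is = Suc 1\<close> by (metis Suc_1 length_2_cases)
      then show ?thesis
        using skew[of "partial_deriv \<alpha> f u" "partial_deriv \<gamma> f u"]
        by (simp add: sym_part_2 cov[OF f u])
    qed
    show "smooth_on U (coord_components ?K f is)"
      if f: "local_parametrization U f" and "length is = 1" for U f "is"
    proof -
      obtain \<alpha> where "is = [\<alpha>]"
        using \<open>length is = 1\<close> by (auto simp: length_Suc_conv)
      then show ?thesis
        unfolding comp by (simp add: comp)
          (intro smooth_on_bilinear[OF _ \<Phi>] smooth_on_partial_deriv param_smooth[OF f] param_open[OF f])
    qed
    show "?K x (vs[k := a *\<^sub>R v + b *\<^sub>R w]) = a * ?K x (vs[k := v]) + b * ?K x (vs[k := w])"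
      if "length vs = 1" "k < 1" for x vs k v w and a b :: real
      using that by (simp add: \<Phi>.add_left \<Phi>.scaleR_left)
    show "?K x (permute_list \<sigma> vs) = ?K x vs" if "\<sigma> permutes {..<1}" for x vs \<sigma>
    proof -
      have "{..<1::nat} = {0}" by auto
      then show ?thesis using that by simp
    qed
  qed
qed

text \<open>With v and x packed into a matrix, the expression \<open>C i k j l\<close> contracted
  with v, x, w, x becomes a bilinear form in two matrices, and bilinear differentiation rules can be
  used at both levels.\<close>

definition outer_product :: "real^'m \<Rightarrow> real^'m \<Rightarrow> real^'m^'m" where
  "outer_product v x = (\<chi> i k. v $ i * x $ k)"

lemma bounded_bilinear_outer_product: "bounded_bilinear (outer_product :: real^'m::finite \<Rightarrow> _)"
  unfolding bilinear_conv_bounded_bilinear[symmetric] bilinear_def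
  by (intro conjI allI linearI) (simp_all add: outer_product_def vec_eq_iff algebra_simps)

interpretation outer_product: bounded_bilinear "outer_product :: real^'m::finite \<Rightarrow> _"
  by (rule bounded_bilinear_outer_product)

text \<open>Again the Gauss formula leaves only the terms in which a factor \<open>f\<close> is
  differentiated, one for each matrix argument. Each is skew in the derivative index and one tensor
  index, so symmetrization removes it.\<close>

lemma bilinear_killing_tensor_field:
  fixes \<Phi> :: "real^'n option^'n option \<Rightarrow> real^('n::finite) option^'n option \<Rightarrow> real"
  assumes \<Phi>: "bounded_bilinear \<Phi>" and sym: "\<And>M N. \<Phi> M N = \<Phi> N M"
    and skew: "\<And>x y N. \<Phi> (outer_product x y) N = - \<Phi> (outer_product y x) N"
  shows "killing_tensor_field 2 (\<lambda>x vs. \<Phi> (outer_product (vs ! 0) x) (outer_product (vs ! 1) x))"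
    (is "killing_tensor_field 2 ?K")
proof -
  let ?o = "outer_product :: real^'n option \<Rightarrow> _"
  interpret \<Phi>: bounded_bilinear \<Phi> by (rule \<Phi>)
  have comp: "coord_components ?K f [\<alpha>, \<beta>] =
      (\<lambda>u. \<Phi> (?o (partial_deriv \<alpha> f u) (f u)) (?o (partial_deriv \<beta> f u) (f u)))" for f \<alpha> \<beta>
    by (simp add: coord_components_def fun_eq_iff)
  have 0: "\<Phi> (?o x x) N = 0" "\<Phi> N (?o x x) = 0" for x N
    using skew[of x x N] sym[of N "?o x x"] by simp_all
  have smooth: "smooth_on U (\<lambda>u. ?o (partial_deriv \<alpha> f u) (f u))"
    if f: "local_parametrization U f" for U f \<alpha>
    by (intro smooth_on_bilinear[OF _ bounded_bilinear_outer_product] smooth_on_partial_deriv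
        param_smooth[OF f] param_open[OF f])
  have cov: "cov_deriv f (coord_components ?K f) [\<alpha>, \<beta>] \<gamma> u =
      \<Phi> (?o (partial_deriv \<alpha> f u) (partial_deriv \<gamma> f u)) (?o (partial_deriv \<beta> f u) (f u)) +
      \<Phi> (?o (partial_deriv \<alpha> f u) (f u)) (?o (partial_deriv \<beta> f u) (partial_deriv \<gamma> f u))"
    if f: "local_parametrization U f" and u: "u \<in> U" for U f \<alpha> \<beta> \<gamma> u
  proof -
    obtain c where c: "partial_deriv \<gamma> (partial_deriv \<alpha> f) u =
        (\<Sum>\<delta>\<in>UNIV. christoffel f \<delta> \<alpha> \<gamma> u *\<^sub>R partial_deriv \<delta> f u) + c *\<^sub>R f u"
      using gauss_formula[OF f u] .
    obtain d where d: "partial_deriv \<gamma> (partial_deriv \<beta> f) u =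
        (\<Sum>\<delta>\<in>UNIV. christoffel f \<delta> \<beta> \<gamma> u *\<^sub>R partial_deriv \<delta> f u) + d *\<^sub>R f u"
      using gauss_formula[OF f u] .
    note o = partial_deriv_bilinear[OF bounded_bilinear_outer_product
        smooth_on_partial_deriv[OF param_smooth[OF f]] param_smooth[OF f] u]
    show ?thesis
      using partial_deriv_bilinear[OF \<Phi> smooth[OF f] smooth[OF f] u] 0
      by (simp add: cov_deriv_2 comp o c d \<Phi>.add_left \<Phi>.sum_left \<Phi>.scaleR_left
          \<Phi>.add_right \<Phi>.sum_right \<Phi>.scaleR_right outer_product.add_left outer_product.sum_left
          outer_product.scaleR_left del: One_nat_def)
  qed
  show ?thesis
  proof (rule killing_tensor_fieldI)
    show "sym_part (\<lambda>js. cov_deriv f (coord_components ?K f) (butlast js) (last js) u) is = 0"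
      if f: "local_parametrization U f" and u: "u \<in> U" and "length is = Suc 2" for U f "is" u
    proof -
      obtain \<alpha> \<beta> \<gamma> where is_eq: "is = [\<alpha>, \<beta>, \<gamma>]"
        using length_3_cases[of "is"] \<open>length is = Suc 2\<close> by auto
      \<comment> \<open>Symmetry of the form writes both terms of the covariant derivative through
        \<open>?S\<close>, which is skew in its first and third index.\<close>
      let ?S = "\<lambda>\<alpha> \<beta> \<gamma>. \<Phi> (?o (partial_deriv \<alpha> f u) (partial_deriv \<gamma> f u)) (?o (partial_deriv \<beta> f u) (f u))"
      have cov': "cov_deriv f (coord_components ?K f) [\<alpha>, \<beta>] \<gamma> u = ?S \<alpha> \<beta> \<gamma> + ?S \<beta> \<alpha> \<gamma>" for \<alpha> \<beta> \<gamma>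
        unfolding cov[OF f u] by (metis sym)
      have S: "?S \<alpha> \<beta> \<gamma> = - ?S \<gamma> \<beta> \<alpha>" for \<alpha> \<beta> \<gamma>
        by (rule skew)
      show ?thesis
        unfolding is_eq sym_part_3
        using S[of \<alpha> \<beta> \<gamma>] S[of \<beta> \<gamma> \<alpha>] S[of \<gamma> \<alpha> \<beta>] by (simp add: cov' del: One_nat_def)
    qed
    show "smooth_on U (coord_components ?K f is)"
      if f: "local_parametrization U f" and "length is = 2" for U f "is"
    proof -
      obtain \<alpha> \<beta> where is_eq: "is = [\<alpha>, \<beta>]"
        using \<open>length is = 2\<close> by (rule length_2_cases)
      show ?thesis
        unfolding is_eq comp by (intro smooth_on_bilinear[OF _ \<Phi>] smooth[OF f] param_open[OF f])
    qed
    show "?K x (vs[k := a *\<^sub>R v + b *\<^sub>R w]) = a * ?K x (vs[k := v]) + b * ?K x (vs[k := w])"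
      if "length vs = 2" "k < 2" for x vs k v w and a b :: real
    proof -
      have "k = 0 \<or> k = 1" using \<open>k < 2\<close> by auto
      then show ?thesis
        using \<open>length vs = 2\<close>
        by (auto simp: outer_product.add_left outer_product.scaleR_left \<Phi>.add_left \<Phi>.scaleR_left
            \<Phi>.add_right \<Phi>.scaleR_right)
    qed
    show "?K x (permute_list \<sigma> vs) = ?K x vs"
      if "length vs = 2" "\<sigma> permutes {..<2}" for x vs \<sigma>
      using that(2)
    proof (cases rule: permutes_2_cases)
      case 2
      then show ?thesis
        using that sym by (simp add: permute_list_nth)
      qed simp
  qed
qed

section \<open>Forms given by constants\<close>

lemma killing_vector_field_of_constants:
  fixes B :: "'n::finite option \<Rightarrow> 'n option \<Rightarrow> real"
  assumes "vector_constants B"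
  obtains K where "killing_vector_field K"
    "\<And>f u \<alpha>. coord_components K f [\<alpha>] u =
      (\<Sum>i\<in>UNIV. partial_deriv \<alpha> f u $ i * vector_coeff B i (f u))"
proof -
  define A where "A = (\<chi> i j. 2 * B i j)"
  let ?\<Phi> = "\<lambda>v x. v \<bullet> (A *v x)"
  have B: "B i j = - B j i" for i j
    using iffD1[OF vector_constants_iff assms] by blast
  have "?\<Phi> x y = - ?\<Phi> y x" for x y
  proof -
    have expand: "?\<Phi> x y = (\<Sum>i\<in>UNIV. \<Sum>j\<in>UNIV. 2 * B i j * (x $ i * y $ j))" for x y
      by (simp add: A_def inner_vec_def matrix_vector_mult_def sum_distrib_left mult_ac)
    have "?\<Phi> x y = (\<Sum>i\<in>UNIV. \<Sum>j\<in>UNIV. - (2 * B j i * (y $ j * x $ i)))"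
      unfolding expand by (intro sum.cong refl) (subst B, simp)
    also have "\<dots> = - ?\<Phi> y x"
      unfolding expand by (subst sum.swap) (simp add: sum_negf)
    finally show ?thesis .
  qed
  then have "killing_vector_field (\<lambda>x vs. ?\<Phi> (vs ! 0) x)"
    by (rule bilinear_killing_vector_field[OF bounded_bilinear_inner_matrix])
  then show ?thesis
    by (rule that)
      (simp add: A_def coord_components_def inner_vec_def matrix_vector_mult_def vector_coeff_def)
qed

lemma killing_tensor_field_of_constants:
  fixes C :: "'n::finite option \<Rightarrow> 'n option \<Rightarrow> 'n option \<Rightarrow> 'n option \<Rightarrow> real"
  assumes "tensor_constants C"
  obtains K where "killing_tensor_field 2 K"
    "\<And>f u \<alpha> \<beta>. coord_components K f [\<alpha>, \<beta>] u =
      (\<Sum>i\<in>UNIV. \<Sum>j\<in>UNIV. partial_deriv \<alpha> f u $ i * partial_deriv \<beta> f u $ j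
        * tensor_coeff C i j (f u))"
proof -
  \<comment> \<open>The first matrix meets the pair \<open>i k\<close> and the second the pair
    \<open>j l\<close>, as in \<open>tensor_coeff\<close>; pair exchange of \<open>C\<close> becomes
    symmetry of the form.\<close>
  define \<Phi> where "\<Phi> M N =
    (\<Sum>i\<in>UNIV. \<Sum>k\<in>UNIV. \<Sum>j\<in>UNIV. \<Sum>l\<in>UNIV. 4 * C i k j l * M $ i $ k * N $ j $ l)"
    for M N :: "real^'n option^'n option"
  have skew: "C i j k l = - C j i k l" and pair: "C i j k l = C k l i j" for i j k l
    using iffD1[OF tensor_constants_iff assms] by blast+
  have bilinear: "bounded_bilinear \<Phi>"
    unfolding bilinear_conv_bounded_bilinear[symmetric] bilinear_def \<Phi>_def
    by (intro conjI allI linearI) (simp_all add: algebra_simps sum.distrib sum_distrib_left)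
  have sym: "\<Phi> M N = \<Phi> N M" for M N
  proof -
    \<comment> \<open>Treating a pair of indices as one index lets a single exchange of sums swap
      both pairs.\<close>
    have pair_sum: "(\<Sum>i\<in>UNIV. \<Sum>k\<in>UNIV. F i k) = (\<Sum>p\<in>UNIV. F (fst p) (snd p))"
      for F :: "'n option \<Rightarrow> 'n option \<Rightarrow> real"
      by (simp add: sum.cartesian_product case_prod_beta)
    have expand: "\<Phi> M N = (\<Sum>p\<in>UNIV. \<Sum>q\<in>UNIV.
        4 * C (fst p) (snd p) (fst q) (snd q) * M $ fst p $ snd p * N $ fst q $ snd q)" for M N
      unfolding \<Phi>_def by (simp only: pair_sum)
    show ?thesis
      unfolding expand by (subst sum.swap) (intro sum.cong refl, subst pair, simp)
  qed
  have skew': "\<Phi> (outer_product x y) N = - \<Phi> (outer_product y x) N" for x y N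
  proof -
    have "\<Phi> (outer_product x y) N = (\<Sum>i\<in>UNIV. \<Sum>k\<in>UNIV. \<Sum>j\<in>UNIV. \<Sum>l\<in>UNIV.
        - (4 * C k i j l * outer_product y x $ k $ i * N $ j $ l))"
      unfolding \<Phi>_def by (intro sum.cong refl) (subst skew, simp add: outer_product_def)
    also have "\<dots> = - \<Phi> (outer_product y x) N"
      by (subst sum.swap) (simp add: \<Phi>_def sum_negf)
    finally show ?thesis .
  qed
  have "\<Phi> (outer_product v x) (outer_product w x) =
      (\<Sum>i\<in>UNIV. \<Sum>j\<in>UNIV. v $ i * w $ j * tensor_coeff C i j x)" for v w x
  proof -
    have "(\<Sum>k\<in>UNIV. \<Sum>j\<in>UNIV. \<Sum>l\<in>UNIV. 4 * C i k j l * (v $ i * x $ k) * (w $ j * x $ l)) =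
        (\<Sum>j\<in>UNIV. v $ i * w $ j * tensor_coeff C i j x)" for i
      by (subst sum.swap) (simp add: tensor_coeff_def sum_distrib_left mult_ac)
    then show ?thesis by (simp add: \<Phi>_def outer_product_def)
  qed
  then show ?thesis
    using bilinear_killing_tensor_field[OF bilinear sym skew']
    by (intro that) (auto simp: coord_components_def)
qed

section \<open>Killing tensor fields along great circles\<close>

text \<open>Reads off the Killing equation with all indices equal, the only instance that necessity
  uses.\<close>

lemma sym_part_replicate: "sym_part T (replicate m a) = T (replicate m a)"
proof -
  have "permute_list \<sigma> (replicate m a) = replicate m a" if "\<sigma> permutes {..<m}" for \<sigma>
  proof (rule nth_equalityI)
    fix i assume "i < length (permute_list \<sigma> (replicate m a))"
    then have "i < m" by simp
    moreover have "\<sigma> i < m"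
      using permutes_in_image[OF that, of i] \<open>i < m\<close> by simp
    ultimately show "permute_list \<sigma> (replicate m a) ! i = replicate m a ! i"
      using that by (subst permute_list_nth) auto
  qed simp
  then have "(\<Sum>\<sigma> | \<sigma> permutes {..<m}. T (permute_list \<sigma> (replicate m a))) =
      (\<Sum>\<sigma> | \<sigma> permutes {..<m}. T (replicate m a))"
    by (intro sum.cong) auto
  then show ?thesis
    by (simp add: sym_part_def card_permutations[where n = m])
qed

lemma tensor_field_multilinear:
  assumes "tensor_field p K" "x \<in> sphere 0 1" "length vs = p"
    "set vs \<subseteq> sphere_tangent_space x" "k < p"
    "v \<in> sphere_tangent_space x" "w \<in> sphere_tangent_space x"
  shows "K x (vs[k := a *\<^sub>R v + b *\<^sub>R w]) = a * K x (vs[k := v]) + b * K x (vs[k := w])"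
  using assms(1)[unfolded tensor_field_def, THEN conjunct1, rule_format, OF assms(2-7)] .

lemma sphere_tangent_space_scaleR:
  "v \<in> sphere_tangent_space x \<Longrightarrow> c *\<^sub>R v \<in> sphere_tangent_space x"
  by (simp add: sphere_tangent_space_def)

text \<open>The slots are rescaled one at a time, by induction on the number \<open>j\<close> of
  slots already done.\<close>

lemma tensor_field_power:
  assumes K: "tensor_field p K" and x: "x \<in> sphere 0 1" and v: "v \<in> sphere_tangent_space x"
  shows "K x (replicate p (c *\<^sub>R v)) = c ^ p * K x (replicate p v)"
proof -
  have "K x (replicate j (c *\<^sub>R v) @ replicate (p - j) v) = c ^ j * K x (replicate p v)" if "j \<le> p" for j
    using that
  proof (induction j)
    case (Suc j)
    let ?vs = "replicate j (c *\<^sub>R v) @ replicate (p - j) v"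
    obtain m where m: "p - j = Suc m" "p - Suc j = m"
      using Suc.prems by (metis Suc_diff_Suc Suc_le_lessD)
    \<comment> \<open>Multilinearity is available for a combination of two vectors, so a zero
      multiple pads the second place.\<close>
    have "K x (?vs[j := c *\<^sub>R v + 0 *\<^sub>R v]) = c * K x (?vs[j := v]) + 0 * K x (?vs[j := v])"
      using Suc.prems v sphere_tangent_space_scaleR[OF v]
      by (intro tensor_field_multilinear[OF K x]) auto
    moreover have "?vs[j := v] = ?vs"
      by (simp add: list_update_append m)
    moreover have "?vs[j := c *\<^sub>R v] = replicate (Suc j) (c *\<^sub>R v) @ replicate (p - Suc j) v"
      by (simp add: list_update_append m replicate_app_Cons_same)
    ultimately show ?case
      using Suc by simp
  qed simp
  from this[of p] show ?thesis by simp
qed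

text \<open>The tangent hyperplane has dimension \<open>n\<close>, so it is isometric to the
  parameter space; a preliminary orthogonal map aligns the chosen axis with
  \<open>v\<close>.\<close>

lemma tangent_frame:
  fixes x v :: "real^('n::finite) option"
  assumes x: "norm x = 1" and v: "x \<bullet> v = 0" "norm v = 1"
  obtains L :: "real^'n \<Rightarrow> real^'n option"
    where "linear L" "\<And>u w. L u \<bullet> L w = u \<bullet> w" "\<And>u. x \<bullet> L u = 0" "L (axis \<alpha> 1) = v"
proof -
  let ?T = "{y. x \<bullet> y = 0}"
  have T: "subspace ?T" by (rule subspace_hyperplane)
  have "dim ?T = dim (UNIV :: (real^'n) set)"
    using x by (subst dim_hyperplane) (auto simp: card_UNIV_option)
  then obtain L0 :: "real^'n \<Rightarrow> real^'n option" and g where L0: "linear L0" "L0 ` UNIV = ?T"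
    and norm: "\<And>u. norm (L0 u) = norm u"
    using isometries_subspaces[OF subspace_UNIV T, where 'a = "real^'n"] by (metis UNIV_I)
  obtain u0 where u0: "L0 u0 = v" using L0(2) v by (metis (mono_tags) imageE mem_Collect_eq)
  then have "norm (axis \<alpha> (1::real)) = norm u0"
    using norm v by (metis norm_axis_1)
  then obtain R where R: "orthogonal_transformation R" "R (axis \<alpha> (1::real)) = u0"
    using orthogonal_transformation_exists by metis
  \<comment> \<open>Polarization turns preservation of norms into preservation of inner
    products.\<close>
  have inner: "L0 u \<bullet> L0 w = u \<bullet> w" for u w
    by (simp only: dot_norm norm flip: linear_add[OF L0(1)])
  show ?thesis
  proof (rule that[of "L0 \<circ> R"])
    show "linear (L0 \<circ> R)"
      using L0(1) R(1) by (intro linear_compose) (auto simp: orthogonal_transformation_def)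
    show "(L0 \<circ> R) u \<bullet> (L0 \<circ> R) w = u \<bullet> w" for u w
      using R(1) by (simp add: inner orthogonal_transformation_def)
    show "x \<bullet> (L0 \<circ> R) u = 0" for u using L0(2) rangeI[of L0 "R u"] by simp
    show "(L0 \<circ> R) (axis \<alpha> 1) = v" by (simp add: R u0)
  qed
qed

section \<open>Smoothness of the height function of a hemisphere\<close>

lemma inner_self_less_one: "u \<in> ball 0 1 \<Longrightarrow> u \<bullet> u < 1" for u :: "'a::real_inner"
  by (simp add: norm_eq_sqrt_inner)

text \<open>The derivative is a linear factor times the cube of the function itself, so smoothness
  follows by induction on the order.\<close>

lemma has_derivative_inverse_sqrt:
  fixes u :: "'a::real_inner"
  assumes "u \<in> ball 0 1"
  shows "((\<lambda>u. 1 / sqrt (1 - u \<bullet> u)) has_derivative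
    (\<lambda>v. (u \<bullet> v) * (1 / sqrt (1 - u \<bullet> u)) ^ 3)) (at u)"
proof -
  let ?q = "1 - u \<bullet> u"
  have q: "?q > 0" using inner_self_less_one[OF assms] by simp
  have "((\<lambda>u. 1 - u \<bullet> u) has_derivative (\<lambda>v. - (2 * (u \<bullet> v)))) (at u)"
    by (auto intro!: derivative_eq_intros simp: inner_commute)
  moreover have "((\<lambda>s. 1 / sqrt s) has_real_derivative - (1 / (2 * (sqrt ?q) ^ 3))) (at ?q)"
    using q by (auto intro!: derivative_eq_intros simp: field_simps power3_eq_cube)
  ultimately have "((\<lambda>u. 1 / sqrt (1 - u \<bullet> u)) has_derivative
      (\<lambda>v. - (1 / (2 * (sqrt ?q) ^ 3)) * - (2 * (u \<bullet> v)))) (at u)"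
    unfolding has_field_derivative_def by (rule has_derivative_compose)
  then show ?thesis
    by (simp add: power_one_over)
qed

lemma smooth_on_inverse_sqrt: "smooth_on (ball 0 1) (\<lambda>u::'a::real_inner. 1 / sqrt (1 - u \<bullet> u))"
proof -
  have "times_diff_on k (ball 0 1) (\<lambda>u::'a. 1 / sqrt (1 - u \<bullet> u))" for k
  proof (induction k)
    case 0
    have "isCont (\<lambda>u::'a. 1 / sqrt (1 - u \<bullet> u)) u" if "u \<in> ball 0 1" for u
      using has_derivative_continuous[OF has_derivative_inverse_sqrt[OF that]] .
    then show ?case
      by (simp add: continuous_at_imp_continuous_on)
  next
    case (Suc k)
    show ?case
    proof (rule times_diff_on_SucI[OF open_ball has_derivative_inverse_sqrt])
      show "times_diff_on k (ball 0 1) (\<lambda>u. (u \<bullet> v) * (1 / sqrt (1 - u \<bullet> u)) ^ 3)" for v :: 'a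
        unfolding power3_eq_cube
        by (intro times_diff_on_bilinear[OF _ bounded_bilinear_mult] Suc
            times_diff_on_bounded_linear bounded_linear_inner_left open_ball)
    qed
  qed
  then show ?thesis by (simp add: smooth_on_def)
qed

text \<open>The derivative is a linear factor times the inverse square root, whose smoothness is
  already established.\<close>

lemma has_derivative_sqrt_height:
  fixes u :: "'a::real_inner"
  assumes "u \<in> ball 0 1"
  shows "((\<lambda>u. sqrt (1 - u \<bullet> u)) has_derivative
    (\<lambda>v. - (u \<bullet> v) * (1 / sqrt (1 - u \<bullet> u)))) (at u)"
  using inner_self_less_one[OF assms]
  by (auto intro!: derivative_eq_intros simp: inner_commute field_simps)

lemma smooth_on_sqrt_height: "smooth_on (ball 0 1) (\<lambda>u::'a::real_inner. sqrt (1 - u \<bullet> u))"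
proof -
  have "times_diff_on (Suc k) (ball 0 1) (\<lambda>u::'a. sqrt (1 - u \<bullet> u))" for k
  proof (rule times_diff_on_SucI[OF open_ball has_derivative_sqrt_height])
    show "times_diff_on k (ball 0 1) (\<lambda>u. - (u \<bullet> v) * (1 / sqrt (1 - u \<bullet> u)))" for v :: 'a
    proof (rule times_diff_on_bilinear[OF open_ball bounded_bilinear_mult])
      show "times_diff_on k (ball 0 1) (\<lambda>u. - (u \<bullet> v))"
        by (intro times_diff_on_bounded_linear bounded_linear_minus bounded_linear_inner_left open_ball)
      show "times_diff_on k (ball 0 1) (\<lambda>u::'a. 1 / sqrt (1 - u \<bullet> u))"
        using smooth_on_inverse_sqrt[where 'a = 'a] by (simp add: smooth_on_def)
    qed
  qed
  then have "times_diff_on k (ball 0 1) (\<lambda>u::'a. sqrt (1 - u \<bullet> u))" for k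
    by (rule times_diff_on_SucD)
  then show ?thesis by (simp add: smooth_on_def)
qed

text \<open>This chart is convenient because at its center \<open>u = 0\<close> the Christoffel symbols vanish, and the
  coordinate lines through the center are great circles.\<close>

definition hemisphere_graph :: "'b::real_vector \<Rightarrow> ('a::real_inner \<Rightarrow> 'b) \<Rightarrow> 'a \<Rightarrow> 'b" where
  "hemisphere_graph x L u = L u + sqrt (1 - u \<bullet> u) *\<^sub>R x"

section \<open>The hemisphere graph as a chart\<close>

context
  fixes x :: "real^('n::finite) option" and L :: "real^'n \<Rightarrow> real^'n option"
    and f :: "real^'n \<Rightarrow> real^'n option"
  assumes x: "norm x = 1" and L: "linear L" "\<And>u w. L u \<bullet> L w = u \<bullet> w" "\<And>u. x \<bullet> L u = 0"
  defines "f \<equiv> hemisphere_graph x L"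
begin

lemma graph_xx: "x \<bullet> x = 1"
  using x by (simp add: norm_eq_1)

lemma graph_has_derivative:
  assumes "u \<in> ball 0 1"
  shows "(f has_derivative (\<lambda>v. L v - ((u \<bullet> v) * (1 / sqrt (1 - u \<bullet> u))) *\<^sub>R x)) (at u)"
proof -
  have "(L has_derivative L) (at u)"
    using L(1) by (simp add: linear_imp_has_derivative)
  from has_derivative_add[OF this has_derivative_scaleR_left[OF has_derivative_sqrt_height[OF assms]]]
  show ?thesis by (simp add: f_def hemisphere_graph_def [abs_def])
qed

lemma graph_frechet_derivative:
  "u \<in> ball 0 1 \<Longrightarrow>
    frechet_derivative f (at u) v = L v - ((u \<bullet> v) * (1 / sqrt (1 - u \<bullet> u))) *\<^sub>R x"
  by (simp flip: frechet_derivative_at[OF graph_has_derivative])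

lemma graph_partial_deriv:
  "u \<in> ball 0 1 \<Longrightarrow>
    partial_deriv \<alpha> f u = L (axis \<alpha> 1) - (u $ \<alpha> * (1 / sqrt (1 - u \<bullet> u))) *\<^sub>R x"
  by (simp add: partial_deriv_def graph_frechet_derivative inner_axis)

lemma graph_local_parametrization: "local_parametrization (ball 0 1) f"
  unfolding local_parametrization_def
proof (intro conjI ballI)
  have "bounded_linear L" using L(1) by (simp add: linear_conv_bounded_linear)
  then show "smooth_on (ball 0 1) f"
    unfolding f_def hemisphere_graph_def [abs_def]
    by (intro smooth_on_add smooth_on_bounded_linear smooth_on_sqrt_height open_ball
        smooth_on_bounded_linear_compose[where L = "\<lambda>s. s *\<^sub>R x"] bounded_linear_scaleR_left)
  show "f ` ball 0 1 \<subseteq> sphere 0 1"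
  proof (rule image_subsetI)
    fix u :: "real^'n" assume "u \<in> ball 0 1"
    then have "f u \<bullet> f u = 1"
      using inner_self_less_one[of u] L(3)[of u]
      by (simp add: f_def hemisphere_graph_def inner_add_left inner_add_right L(2) graph_xx inner_commute[of "L u" x])
    then show "f u \<in> sphere 0 1" by (simp add: norm_eq_1)
  qed
  \<comment> \<open>Pairing with the image of \<open>L\<close> recovers \<open>u\<close> from
    \<open>f u\<close>; the same pairing gives injectivity of the derivative.\<close>
  have inner_L: "f u \<bullet> L w = u \<bullet> w" for u w
    by (simp add: f_def hemisphere_graph_def inner_add_left L)
  show "inj_on f (ball 0 1)"
  proof (rule inj_onI)
    fix u w assume "f u = f w"
    then have "u \<bullet> y = w \<bullet> y" for y using inner_L by metis
    then show "u = w" by (metis vector_eq_rdot)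
  qed
  show "inj (frechet_derivative f (at u))" if "u \<in> ball 0 1" for u
  proof (rule injI)
    fix v w assume "frechet_derivative f (at u) v = frechet_derivative f (at u) w"
    then have "frechet_derivative f (at u) v \<bullet> L y = frechet_derivative f (at u) w \<bullet> L y" for y
      by simp
    then have "v \<bullet> y = w \<bullet> y" for y
      by (simp add: graph_frechet_derivative[OF that] inner_diff_left L)
    then show "v = w" by (metis vector_eq_rdot)
  qed
qed auto

text \<open>The coordinate vectors vary only by multiples of \<open>x\<close>, which are orthogonal
  to the tangent space at the center.\<close>

lemma graph_christoffel: "christoffel f \<gamma> \<alpha> \<beta> 0 = 0"
proof -
  let ?g = "\<lambda>u::real^'n. u $ \<beta> * (1 / sqrt (1 - u \<bullet> u))"
  have z: "(0::real^'n) \<in> ball 0 1" by simp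
  have "smooth_on (ball 0 1) ?g"
    by (intro smooth_on_mult smooth_on_inverse_sqrt smooth_on_bounded_linear
        bounded_linear_vec_nth open_ball)
  then have g: "smooth_on (ball 0 1) (\<lambda>u. - ?g u)"
    by (rule smooth_on_bounded_linear_compose[OF open_ball bounded_linear_minus[OF bounded_linear_ident]])
  have "partial_deriv \<alpha> (partial_deriv \<beta> f) 0 = partial_deriv \<alpha> (\<lambda>u. L (axis \<beta> 1) + (- ?g u) *\<^sub>R x) 0"
    by (rule partial_deriv_cong_open[OF open_ball z]) (simp add: graph_partial_deriv)
  also have "\<dots> = 0 + frechet_derivative (\<lambda>u. - ?g u) (at 0) (axis \<alpha> 1) *\<^sub>R x"
    by (rule partial_deriv_eqI[OF has_derivative_add[OF has_derivative_const
            has_derivative_scaleR_left[OF smooth_on_has_derivative[OF g z]]]])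
  finally have "partial_deriv \<alpha> (partial_deriv \<beta> f) 0 \<bullet> partial_deriv \<delta> f 0 = 0" for \<delta>
    by (simp add: graph_partial_deriv[OF z] L(3))
  then show ?thesis
    by (simp add: christoffel_eq[OF graph_local_parametrization z])
qed

text \<open>The parameter is \<open>sin t\<close>, so by the chain rule the velocity of the circle
  is \<open>cos t\<close> times the coordinate vector. The bound on \<open>t\<close> keeps the
  circle in the open hemisphere.\<close>

lemma graph_great_circle:
  assumes "\<bar>t\<bar> < pi / 2"
  shows "sin t *\<^sub>R axis \<alpha> 1 \<in> ball (0::real^'n) 1"
    and "f (sin t *\<^sub>R axis \<alpha> 1) = cos t *\<^sub>R x + sin t *\<^sub>R L (axis \<alpha> 1)"
    and "cos t *\<^sub>R partial_deriv \<alpha> f (sin t *\<^sub>R axis \<alpha> 1) = cos t *\<^sub>R L (axis \<alpha> 1) - sin t *\<^sub>R x"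
proof -
  have c: "cos t > 0" using assms by (intro cos_gt_zero_pi) auto
  have "(sin t)\<^sup>2 < 1" using c sin_cos_squared_add[of t] by (smt (verit) zero_less_power)
  then have "\<bar>sin t\<bar> < 1" by (simp add: abs_square_less_1)
  then show u: "sin t *\<^sub>R axis \<alpha> 1 \<in> ball (0::real^'n) 1" by simp
  have s: "sqrt (1 - (sin t *\<^sub>R axis \<alpha> 1) \<bullet> (sin t *\<^sub>R axis \<alpha> (1::real))) = cos t"
    using c by (simp add: inner_axis_axis cos_squared_eq[symmetric] flip: power2_eq_square)
  show "f (sin t *\<^sub>R axis \<alpha> 1) = cos t *\<^sub>R x + sin t *\<^sub>R L (axis \<alpha> 1)"
    unfolding f_def hemisphere_graph_def s by (simp add: linear_cmul[OF L(1)])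
  show "cos t *\<^sub>R partial_deriv \<alpha> f (sin t *\<^sub>R axis \<alpha> 1) = cos t *\<^sub>R L (axis \<alpha> 1) - sin t *\<^sub>R x"
    unfolding graph_partial_deriv[OF u] s using c by (simp add: scaleR_diff_right)
qed

end

text \<open>By homogeneity the function is \<open>cos t ^ p\<close> times the component with all
  indices \<alpha>, taken at \<open>sin t\<close> on the \<alpha>-axis. At the center the partial
  derivative of that component along \<alpha> is a covariant derivative, which the Killing equation
  sets to zero.\<close>

lemma killing_great_circle_derivative:
  fixes K :: "'n::finite ambient_field"
  assumes K: "killing_tensor_field p K" and x: "norm x = 1" and v: "x \<bullet> v = 0" "norm v = 1"
  shows "((\<lambda>t. K (cos t *\<^sub>R x + sin t *\<^sub>R v) (replicate p (cos t *\<^sub>R v - sin t *\<^sub>R x)))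
    has_real_derivative 0) (at 0)"
proof -
  \<comment> \<open>Any axis will do; the frame is turned so that it points along
    \<open>v\<close>.\<close>
  fix \<alpha> :: 'n
  obtain L :: "real^'n \<Rightarrow> real^'n option"
    where L: "linear L" "\<And>u w. L u \<bullet> L w = u \<bullet> w" "\<And>u. x \<bullet> L u = 0" "L (axis \<alpha> 1) = v"
    using tangent_frame[OF x v] by blast
  define f where "f = hemisphere_graph x L"
  note graph = x L(1-3)
  have f: "local_parametrization (ball 0 1) f"
    unfolding f_def by (rule graph_local_parametrization[OF graph])
  define k where "k = coord_components K f (replicate p \<alpha>)"
  have tensor: "tensor_field p K" using K by (simp add: killing_tensor_field_def)
  have z: "(0::real^'n) \<in> ball 0 1" by simp
  have "smooth_on (ball 0 1) k"
    unfolding k_def using tensor f by (simp add: tensor_field_def)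
  then have Dk: "(k has_derivative frechet_derivative k (at 0)) (at 0)"
    using z by (rule smooth_on_has_derivative)
  have "sym_part (\<lambda>js. cov_deriv f (coord_components K f) (butlast js) (last js) 0)
      (replicate (Suc p) \<alpha>) = 0"
    using K f z unfolding killing_tensor_field_def by (metis length_replicate)
  moreover have "butlast (replicate (Suc p) \<alpha>) = replicate p \<alpha>"
    by (metis butlast_snoc replicate_append_same replicate_Suc)
  moreover have "last (replicate (Suc p) \<alpha>) = \<alpha>"
    by (metis last_snoc replicate_append_same replicate_Suc)
  moreover have "christoffel f \<gamma> \<delta> \<beta> 0 = 0" for \<gamma> \<delta> \<beta>
    unfolding f_def by (rule graph_christoffel[OF graph])
  ultimately have "partial_deriv \<alpha> k 0 = 0"
    unfolding sym_part_replicate by (simp add: cov_deriv_def k_def del: replicate_Suc)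
  then have Dk0: "frechet_derivative k (at 0) (c *\<^sub>R axis \<alpha> 1) = 0" for c
    using linear_cmul[OF has_derivative_linear[OF Dk]] by (simp add: partial_deriv_def)
  have "((\<lambda>t. sin t *\<^sub>R axis \<alpha> 1) has_derivative (\<lambda>h. h *\<^sub>R axis \<alpha> 1)) (at (0::real))"
    by (auto intro!: derivative_eq_intros)
  moreover have "(k has_derivative frechet_derivative k (at 0)) (at (sin 0 *\<^sub>R axis \<alpha> 1))"
    using Dk by simp
  ultimately have "((\<lambda>t. k (sin t *\<^sub>R axis \<alpha> 1)) has_derivative
      (\<lambda>h. frechet_derivative k (at 0) (h *\<^sub>R axis \<alpha> 1))) (at 0)"
    by (rule has_derivative_compose)
  then have Dk': "((\<lambda>t. k (sin t *\<^sub>R axis \<alpha> 1)) has_real_derivative 0) (at 0)"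
    by (simp add: Dk0 has_field_derivative_def lambda_zero)
  \<comment> \<open>The homogeneity factor is stationary at 0 and does not disturb the
    derivative.\<close>
  have "((\<lambda>t::real. cos t ^ p) has_real_derivative
      of_nat p * (- sin 0 * cos 0 ^ (p - Suc 0))) (at 0)"
    by (rule DERIV_power[OF DERIV_cos])
  from DERIV_mult[OF this Dk']
  have D: "((\<lambda>t. cos t ^ p * k (sin t *\<^sub>R axis \<alpha> 1)) has_real_derivative 0) (at 0)"
    by simp
  have eq: "cos t ^ p * k (sin t *\<^sub>R axis \<alpha> 1) =
      K (cos t *\<^sub>R x + sin t *\<^sub>R v) (replicate p (cos t *\<^sub>R v - sin t *\<^sub>R x))"
    if "t \<in> {- (pi / 2)<..<pi / 2}" for t
  proof -
    let ?u = "sin t *\<^sub>R axis \<alpha> (1::real)"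
    have "\<bar>t\<bar> < pi / 2" using that by auto
    note gc = graph_great_circle[OF graph this, of \<alpha>, folded f_def, unfolded L(4)]
    have "f ?u \<in> sphere 0 1"
      using f gc(1) unfolding local_parametrization_def by blast
    moreover have "partial_deriv \<alpha> f ?u \<in> sphere_tangent_space (f ?u)"
      using param_tangent[OF f gc(1)] by (simp add: sphere_tangent_space_def)
    ultimately have "K (f ?u) (replicate p (cos t *\<^sub>R partial_deriv \<alpha> f ?u)) = cos t ^ p * k ?u"
      using tensor_field_power[OF tensor] by (simp add: k_def coord_components_def)
    then show ?thesis by (simp only: gc(2,3))
  qed
  show ?thesis
    by (rule has_field_derivative_transform_within_open[OF D
          open_greaterThanLessThan[of "- (pi / 2)" "pi / 2"] _ eq]) (use pi_half_gt_zero in auto)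
qed

text \<open>The point and velocity at parameter \<open>s\<close> are again an orthonormal pair
  spanning the same circle, so the angle addition formulas reduce the derivative at \<open>s\<close>
  to the one at 0.\<close>

lemma killing_great_circle:
  fixes K :: "'n::finite ambient_field"
  assumes K: "killing_tensor_field p K" and x: "norm x = 1" and v: "x \<bullet> v = 0" "norm v = 1"
  shows "K (cos t *\<^sub>R x + sin t *\<^sub>R v) (replicate p (cos t *\<^sub>R v - sin t *\<^sub>R x)) = K x (replicate p v)"
proof -
  define h where "h t = K (cos t *\<^sub>R x + sin t *\<^sub>R v) (replicate p (cos t *\<^sub>R v - sin t *\<^sub>R x))" for t
  have "(h has_real_derivative 0) (at s)" for s
  proof -
    define y w where yw: "y = cos s *\<^sub>R x + sin s *\<^sub>R v" "w = cos s *\<^sub>R v - sin s *\<^sub>R x"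
    have xx: "x \<bullet> x = 1" "v \<bullet> v = 1" "v \<bullet> x = 0"
      using x v by (simp_all add: norm_eq_1 inner_commute)
    have "norm y = 1" "y \<bullet> w = 0" "norm w = 1"
      using xx v(1) sin_cos_squared_add[of s]
      by (simp_all add: yw norm_eq_1 inner_add_left inner_add_right inner_diff_left inner_diff_right
          power2_eq_square algebra_simps)
    then have "((\<lambda>t. K (cos t *\<^sub>R y + sin t *\<^sub>R w) (replicate p (cos t *\<^sub>R w - sin t *\<^sub>R y)))
        has_real_derivative 0) (at 0)"
      by (rule killing_great_circle_derivative[OF K])
    moreover have "cos t *\<^sub>R y + sin t *\<^sub>R w = cos (t + s) *\<^sub>R x + sin (t + s) *\<^sub>R v"
      "cos t *\<^sub>R w - sin t *\<^sub>R y = cos (t + s) *\<^sub>R v - sin (t + s) *\<^sub>R x" for t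
      by (simp_all add: yw sin_add cos_add algebra_simps)
    ultimately have "((\<lambda>t. h (t + s)) has_real_derivative 0) (at 0)"
      by (simp only: h_def)
    then show ?thesis
      using DERIV_shift[of h 0 0 s] by simp
  qed
  then have "h t = h 0"
    using DERIV_isconst_all[of h t 0] by blast
  then show ?thesis unfolding h_def by simp
qed

section \<open>Constants from Killing tensor fields\<close>

text \<open>Dividing by \<open>x \<bullet> x\<close> makes the projection depend only on the line
  through \<open>x\<close>. At \<open>x = 0\<close> it returns \<open>v\<close>.\<close>

definition tangent_part :: "'a::real_inner \<Rightarrow> 'a \<Rightarrow> 'a" where
  "tangent_part x v = v - ((x \<bullet> v) / (x \<bullet> x)) *\<^sub>R x"

lemma tangent_part_orthogonal [simp]: "x \<bullet> tangent_part x v = 0"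
  by (simp add: tangent_part_def inner_diff_right)

lemma tangent_part_mem: "tangent_part x v \<in> sphere_tangent_space (sgn x)"
  by (simp add: sphere_tangent_space_def sgn_div_norm)

lemma tangent_part_zero [simp]: "tangent_part x 0 = 0"
  by (simp add: tangent_part_def)

lemma tangent_part_self [simp]: "tangent_part x x = 0"
  by (cases "x = 0") (simp_all add: tangent_part_def)

lemma tangent_part_tangent: "x \<bullet> v = 0 \<Longrightarrow> tangent_part x v = v"
  by (simp add: tangent_part_def)

lemma linear_tangent_part: "linear (tangent_part x)"
  by (rule linearI) (simp_all add: tangent_part_def inner_add_right add_divide_distrib algebra_simps)

lemma sgn_mem_sphere: "x \<noteq> 0 \<Longrightarrow> sgn x \<in> sphere 0 1" for x :: "'a::real_normed_vector"
  by (simp add: norm_sgn)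

text \<open>The extension of \<open>K x (v, \<dots>, v)\<close> to all pairs of vectors that is homogeneous of degree
  \<open>p\<close> in \<open>x\<close> and invariant under adding multiples of \<open>x\<close> to \<open>v\<close>.\<close>

definition extended_form :: "nat \<Rightarrow> 'n::finite ambient_field \<Rightarrow> real^'n option \<Rightarrow> real^'n option \<Rightarrow> real" where
  "extended_form p K x v = norm x ^ p * K (sgn x) (replicate p (tangent_part x v))"

lemma extended_form_eq_0:
  assumes K: "tensor_field p K" and p: "p > 0" and x: "tangent_part x v = 0"
  shows "extended_form p K x v = 0"
proof (cases "x = 0")
  case False
  \<comment> \<open>The zero vector is written as 0 times itself to apply homogeneity;
    \<open>p > 0\<close> makes the factor vanish.\<close>
  have "K (sgn x) (replicate p (0 *\<^sub>R 0)) = 0 ^ p * K (sgn x) (replicate p 0)"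
    by (rule tensor_field_power[OF K sgn_mem_sphere[OF False]]) (simp add: sphere_tangent_space_def)
  then have "K (sgn x) (replicate p 0) = 0"
    unfolding zero_power[OF p] by simp
  then show ?thesis
    by (simp add: extended_form_def x)
qed (use p in \<open>simp add: extended_form_def\<close>)

text \<open>Up to scale, the pairs \<open>(x, v)\<close> and \<open>(v, -x)\<close> are two points of the same lifted great
  circle.\<close>

lemma extended_form_swap:
  fixes K :: "'n::finite ambient_field"
  assumes K: "killing_tensor_field p K" and p: "p > 0"
  shows "extended_form p K v x = (- 1) ^ p * extended_form p K x v"
proof -
  have tensor: "tensor_field p K" using K by (simp add: killing_tensor_field_def)
  note zero = extended_form_eq_0[OF tensor p]
  show ?thesis
  proof (cases "x = 0 \<or> v = 0 \<or> tangent_part x v = 0")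
    case True
    \<comment> \<open>Zero or parallel vectors span no great circle; being parallel is symmetric in
      \<open>x\<close> and \<open>v\<close>, so both forms vanish.\<close>
    have "tangent_part x v = 0 \<and> tangent_part v x = 0" if "x \<noteq> 0" "v \<noteq> 0"
    proof -
      have "v = ((x \<bullet> v) / (x \<bullet> x)) *\<^sub>R x"
        using True that by (simp add: tangent_part_def)
      then obtain a where a: "v = a *\<^sub>R x" by blast
      then show ?thesis
        using that by (simp add: tangent_part_def)
    qed
    then have "extended_form p K x v = 0 \<and> extended_form p K v x = 0"
    proof (cases "x = 0 \<or> v = 0")
      case True
      have "extended_form p K 0 y = 0" for y
        using p by (simp add: extended_form_def)
      then show ?thesis using True zero by auto
    next
      case False
      assume "x \<noteq> 0 \<Longrightarrow> v \<noteq> 0 \<Longrightarrow> tangent_part x v = 0 \<and> tangent_part v x = 0"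
      then show ?thesis using False zero by blast
    qed
    then show ?thesis by simp
  next
    case False
    \<comment> \<open>The orthonormal pair \<open>e\<close>, \<open>w\<close> starts the great
      circle through the directions of \<open>x\<close> and \<open>v\<close>. With (a, s) in polar
      form of radius \<open>r\<close> and angle \<theta>, \<open>sgn v\<close> is its point at angle
      \<theta>, and \<open>tangent_part v x\<close> is a multiple of the velocity there.\<close>
    define \<rho> e s w a r where "\<rho> = norm x" and "e = sgn x" and "s = norm (tangent_part x v)"
      and "w = sgn (tangent_part x v)" and "a = e \<bullet> v" and "r = norm v"
    have pos: "\<rho> > 0" "s > 0" "r > 0"
      using False by (simp_all add: \<rho>_def s_def r_def)
    have e: "norm e = 1" and w: "norm w = 1"
      using False by (simp_all add: e_def w_def norm_sgn)
    have ew: "e \<bullet> w = 0"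
      by (simp add: e_def w_def sgn_div_norm)
    have x: "x = \<rho> *\<^sub>R e" and tp: "tangent_part x v = s *\<^sub>R w"
      using False by (simp_all add: \<rho>_def e_def s_def w_def sgn_div_norm)
    have v: "v = a *\<^sub>R e + s *\<^sub>R w"
    proof -
      have "((x \<bullet> v) / (x \<bullet> x)) *\<^sub>R x = a *\<^sub>R e"
        using pos(1) e unfolding x by (simp add: a_def norm_eq_1)
      then show ?thesis using tp by (simp add: tangent_part_def algebra_simps)
    qed
    have ee: "e \<bullet> e = 1" "w \<bullet> w = 1" "w \<bullet> e = 0"
      using e w ew by (simp_all add: norm_eq_1 inner_commute)
    have vv: "v \<bullet> v = r\<^sup>2" by (simp add: r_def power2_norm_eq_inner)
    have "a\<^sup>2 + s\<^sup>2 = r\<^sup>2"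
      unfolding vv[symmetric] v using ew ee
      by (simp add: inner_add_left inner_add_right power2_eq_square)
    then have "(a / r)\<^sup>2 + (s / r)\<^sup>2 = 1"
      using pos by (simp add: power_divide flip: add_divide_distrib)
    then obtain \<theta> where \<theta>: "a / r = cos \<theta>" "s / r = sin \<theta>"
      using sincos_total_2pi by metis
    then have as: "a = r * cos \<theta>" "s = r * sin \<theta>"
      using pos by (simp_all add: field_simps)
    have sgn_v: "sgn v = cos \<theta> *\<^sub>R e + sin \<theta> *\<^sub>R w"
    proof -
      have "sgn v = inverse r *\<^sub>R v" by (simp add: sgn_div_norm r_def)
      also have "\<dots> = (a / r) *\<^sub>R e + (s / r) *\<^sub>R w"
        using arg_cong[OF v, of "scaleR (inverse r)"]
        by (simp add: scaleR_add_right divide_inverse mult.commute)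
      finally show ?thesis by (simp only: \<theta>)
    qed
    have "tangent_part v x = \<rho> *\<^sub>R (e - cos \<theta> *\<^sub>R (cos \<theta> *\<^sub>R e + sin \<theta> *\<^sub>R w))"
    proof -
      have "v \<bullet> x = r * \<rho> * cos \<theta>"
        unfolding v x using ee by (simp add: inner_add_left as)
      then have "((v \<bullet> x) / (v \<bullet> v)) *\<^sub>R v = (\<rho> * cos \<theta>) *\<^sub>R sgn v"
        using pos by (simp add: vv sgn_div_norm r_def[symmetric] power2_eq_square field_simps)
      then show ?thesis
        by (simp add: tangent_part_def sgn_v x scaleR_diff_right)
    qed
    also have "\<dots> = (- \<rho> * sin \<theta>) *\<^sub>R (cos \<theta> *\<^sub>R w - sin \<theta> *\<^sub>R e)"
    proof -
      have "\<rho> * (cos \<theta> * cos \<theta>) + \<rho> * (sin \<theta> * sin \<theta>) = \<rho>"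
        using sin_cos_squared_add2[of \<theta>] by (simp add: power2_eq_square flip: distrib_left)
      then have "\<rho> *\<^sub>R e = (\<rho> * (cos \<theta> * cos \<theta>)) *\<^sub>R e + (\<rho> * (sin \<theta> * sin \<theta>)) *\<^sub>R e"
        by (simp flip: scaleR_left_distrib)
      then show ?thesis
        by (simp add: algebra_simps)
    qed
    finally have tp': "tangent_part v x = (- \<rho> * sin \<theta>) *\<^sub>R (cos \<theta> *\<^sub>R w - sin \<theta> *\<^sub>R e)" .
    have "cos \<theta> *\<^sub>R w - sin \<theta> *\<^sub>R e \<in> sphere_tangent_space (sgn v)"
      using ee ew by (simp add: sphere_tangent_space_def sgn_v inner_add_left inner_diff_right)
    then have "extended_form p K v x = r ^ p * ((- \<rho> * sin \<theta>) ^ p *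
        K (cos \<theta> *\<^sub>R e + sin \<theta> *\<^sub>R w) (replicate p (cos \<theta> *\<^sub>R w - sin \<theta> *\<^sub>R e)))"
      unfolding extended_form_def tp' sgn_v[symmetric] r_def
      using False by (subst tensor_field_power[OF tensor sgn_mem_sphere]) simp_all
    \<comment> \<open>Constancy along the circle moves the value from angle \<theta> back to 0, and
      \<open>r * sin \<theta>\<close> is \<open>s\<close>.\<close>
    also have "\<dots> = (- \<rho> * s) ^ p * K e (replicate p w)"
      unfolding killing_great_circle[OF K e ew w] as(2) mult.assoc[symmetric] power_mult_distrib[symmetric]
      by (simp add: mult_ac)
    also have "\<dots> = (- 1) ^ p * (\<rho> ^ p * (s ^ p * K e (replicate p w)))"
      using power_mult_distrib[of "- 1" "\<rho> * s" p] by (simp add: power_mult_distrib)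
    also have "\<dots> = (- 1) ^ p * extended_form p K x v"
    proof -
      have "w \<in> sphere_tangent_space (sgn x)"
        using ew by (simp add: sphere_tangent_space_def e_def)
      then have "K (sgn x) (replicate p (s *\<^sub>R w)) = s ^ p * K (sgn x) (replicate p w)"
        using False by (intro tensor_field_power[OF tensor sgn_mem_sphere]) simp_all
      then show ?thesis
        by (simp add: extended_form_def tp \<rho>_def e_def)
    qed
    finally show ?thesis .
  qed
qed

section \<open>From the extended form to the constants\<close>

lemma param_point_extended:
  assumes f: "local_parametrization U f" and u: "u \<in> U"
  shows "norm (f u) = 1" "sgn (f u) = f u" "tangent_part (f u) (partial_deriv \<alpha> f u) = partial_deriv \<alpha> f u"
proof -
  show n: "norm (f u) = 1" using param_unit[OF f u] by (simp add: norm_eq_1)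
  then show "sgn (f u) = f u" by (simp add: sgn_div_norm)
  show "tangent_part (f u) (partial_deriv \<alpha> f u) = partial_deriv \<alpha> f u"
    using param_tangent[OF f u] by (rule tangent_part_tangent)
qed

text \<open>The exchange carries linearity from the vector to the base point, so the extended form
  is alternating bilinear and is given by a skew matrix.\<close>

lemma constants_of_killing_vector_field:
  fixes K :: "'n::finite ambient_field"
  assumes K: "killing_vector_field K"
  obtains B where "vector_constants B"
    "\<And>U f u \<alpha>. local_parametrization U f \<Longrightarrow> u \<in> U \<Longrightarrow> coord_components K f [\<alpha>] u =
      (\<Sum>i\<in>UNIV. partial_deriv \<alpha> f u $ i * vector_coeff B i (f u))"
proof -
  have tensor: "tensor_field 1 K" using K by (simp add: killing_tensor_field_def)
  define b where "b = extended_form 1 K"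
  have b: "b x v = norm x * K (sgn x) [tangent_part x v]" for x v
    by (simp add: b_def extended_form_def)
  have swap: "b x v = - b v x" for x v
    using extended_form_swap[OF K, of x v] by (simp add: b_def)
  have combination: "b x (c *\<^sub>R v + d *\<^sub>R w) = c * b x v + d * b x w" for x v w c d
  proof (cases "x = 0")
    case False
    \<comment> \<open>The entry 0 is a tangent placeholder, overwritten by each update.\<close>
    have "K (sgn x) ([0][0 := c *\<^sub>R tangent_part x v + d *\<^sub>R tangent_part x w]) =
        c * K (sgn x) ([0][0 := tangent_part x v]) + d * K (sgn x) ([0][0 := tangent_part x w])"
      by (rule tensor_field_multilinear[OF tensor sgn_mem_sphere[OF False]])
        (simp_all add: tangent_part_mem, simp add: sphere_tangent_space_def)
    then show ?thesis
      by (simp add: b linear_add[OF linear_tangent_part] linear_cmul[OF linear_tangent_part]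
          distrib_left mult.left_commute)
  qed (simp add: b)
  have linear: "linear (b x)" for x
    using combination[of x 1 _ 1] combination[of x _ _ 0] by (intro linearI) simp_all
  \<comment> \<open>The base point is the first argument of \<open>b\<close>, hence the order
    \<open>j\<close>, \<open>i\<close>; the division by 2 offsets the factor 2 in
    \<open>vector_coeff\<close>.\<close>
  define B where "B i j = b (axis j 1) (axis i 1) / 2" for i j
  show ?thesis
  proof
    have "B i j = - B j i" for i j
      using swap[of "axis j 1" "axis i 1"] by (simp add: B_def)
    then show "vector_constants B"
      by (intro iffD2[OF vector_constants_iff] allI)
    have expand: "b x v = (\<Sum>i\<in>UNIV. v $ i * vector_coeff B i x)" for x v
    proof -
      have "b x (axis i 1) = vector_coeff B i x" for i
      proof -
        have "b x (axis i 1) = - (\<Sum>j\<in>UNIV. x $ j * b (axis i 1) (axis j 1))"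
          using linear_cart_expansion[OF linear, of "axis i 1" x] swap[of x "axis i 1"] by simp
        also have "\<dots> = (\<Sum>j\<in>UNIV. b (axis j 1) (axis i 1) * x $ j)"
          unfolding sum_negf[symmetric] by (intro sum.cong refl) (subst swap, simp)
        finally show ?thesis by (simp add: vector_coeff_def B_def)
      qed
      then show ?thesis
        using linear_cart_expansion[OF linear, of x v] by simp
    qed
    show "coord_components K f [\<alpha>] u = (\<Sum>i\<in>UNIV. partial_deriv \<alpha> f u $ i * vector_coeff B i (f u))"
      if "local_parametrization U f" "u \<in> U" for U f u \<alpha>
      using param_point_extended[OF that]
      by (simp add: coord_components_def b flip: expand)
  qed
qed

text \<open>The polarization \<open>S\<close> of a biquadratic form that is symmetric under exchange of its two
  arguments has the symmetries of a Jacobi tensor, and \<open>C\<close> is the curvature tensor it determines.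
  For the normalization: \<open>S(v,w,x,x) = Q x v w\<close> and \<open>S(x,w,v,x) = - Q x v w / 2\<close>.\<close>

lemma tensor_constants_of_biquadratic:
  fixes Q :: "real^'m::finite \<Rightarrow> real^'m \<Rightarrow> real^'m \<Rightarrow> real"
  assumes linear: "\<And>x w. linear (\<lambda>v. Q x v w)" and sym: "\<And>x v w. Q x v w = Q x w v"
    and swap: "\<And>x v. Q x v v = Q v x x" and null: "\<And>x w. Q x x w = 0"
  obtains C where "tensor_constants C"
    "\<And>x v w. Q x v w = (\<Sum>i\<in>UNIV. \<Sum>j\<in>UNIV. v $ i * w $ j * tensor_coeff C i j x)"
proof -
  \<comment> \<open>Polarization in the base point; linearity in these two slots is not yet
    known.\<close>
  define S where "S x y v w = (Q (x + y) v w - Q x v w - Q y v w) / 2" for x y v w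
  have polar: "2 * Q z v w = Q z (v + w) (v + w) - Q z v v - Q z w w" for z v w
    using linear_add[OF linear, of z v w "v + w"] sym[of z v "v + w"] sym[of z w "v + w"]
      linear_add[OF linear, of z v w v] linear_add[OF linear, of z v w w] sym[of z w v]
    by simp
  have S12: "S x y v w = S y x v w" for x y v w
    by (simp add: S_def add.commute)
  have S34: "S x y v w = S x y w v" for x y v w
    by (simp add: S_def sym[of _ v w])
  \<comment> \<open>Polarizing also in the vectors expresses \<open>S\<close> through values with
    equal vector arguments, the only ones that \<open>swap\<close> covers.\<close>
  have pair: "S x y v w = S v w x y" for x y v w
  proof -
    have "4 * S a b c d = Q (a + b) (c + d) (c + d) - Q (a + b) c c - Q (a + b) d d
        - (Q a (c + d) (c + d) - Q a c c - Q a d d) - (Q b (c + d) (c + d) - Q b c c - Q b d d)"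
      for a b c d
      unfolding S_def polar[symmetric] by simp
    from this[of x y v w] this[of v w x y] show ?thesis
      unfolding swap[of v] swap[of w] swap[of "v + w"] by simp
  qed
  have diag: "S x x v w = Q x v w" for x v w
  proof -
    have "2 * S v w x x = Q x (v + w) (v + w) - Q x v v - Q x w w"
      by (simp add: S_def swap[of _ x])
    then show ?thesis using polar[of x v w] pair[of x x v w] by simp
  qed
  have linear3: "linear (\<lambda>v. S x y v w)" for x y w
    unfolding S_def
    by (intro linear_compose_sub linear linearI)
      (simp_all add: linear_add[OF linear] linear_cmul[OF linear] field_simps)
  \<comment> \<open>Pair exchange transports linearity from the vectors to the base point
    slots.\<close>
  have linear1: "linear (\<lambda>x. S x y v w)" for y v w
    using linear3[of v w y] by (simp add: pair[of _ y v w])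
  have linear2: "linear (\<lambda>y. S x y v w)" for x v w
    using linear1[of x v w] by (simp add: S12[of x])
  have linear4: "linear (\<lambda>w. S x y v w)" for x y v
    using linear3[of x y v] by (simp add: S34[of x y v])
  have mixed: "S x w v x = - Q x v w / 2" for x v w
  proof -
    \<comment> \<open>Vanishing of this cubic form at \<open>x\<close>, \<open>v\<close>,
      \<open>x + v\<close> and \<open>x - v\<close> isolates its part linear in \<open>v\<close>,
      which relates the two placements of the arguments.\<close>
    have cube: "S a a a w = 0" for a by (simp add: diag null)
    have "S (x + v) (x + v) (x + v) w = 0" "S (x - v) (x - v) (x - v) w = 0"
      by (rule cube)+
    then have "S x x v w + 2 * S v x x w = 0"
      using S12[of x v x w] S12[of x v v w] cube[of x] cube[of v]
      by (simp add: linear_add[OF linear1] linear_add[OF linear2] linear_add[OF linear3]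
          linear_diff[OF linear1] linear_diff[OF linear2] linear_diff[OF linear3])
    then show ?thesis
      using pair[of x w v x] diag[of x v w] S34[of v x x w] by simp
  qed
  let ?e = "\<lambda>i. axis i (1::real) :: real^'m"
  define s where "s i j k l = S (?e i) (?e j) (?e k) (?e l)" for i j k l
  \<comment> \<open>The passage from a Jacobi tensor to its curvature tensor. With the 4 of
    \<open>tensor_coeff\<close>, contraction yields 4/6 of \<open>S v w x x - S x w v x\<close>,
    which is 3/2 of \<open>Q x v w\<close>.\<close>
  define C where "C a b c d = (s a c b d - s b c a d) / 6" for a b c d
  have expand: "S a b c d = (\<Sum>i\<in>UNIV. \<Sum>j\<in>UNIV. \<Sum>k\<in>UNIV. \<Sum>l\<in>UNIV. a $ i * b $ j * c $ k * d $ l * s i j k l)"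
    for a b c d
  proof -
    have "S a b c d = (\<Sum>i\<in>UNIV. a $ i * S (?e i) b c d)"
      using linear_cart_expansion[OF linear1, of a] by simp
    also have "\<dots> = (\<Sum>i\<in>UNIV. a $ i * (\<Sum>j\<in>UNIV. b $ j * S (?e i) (?e j) c d))"
      unfolding linear_cart_expansion[OF linear2, of _ b] by simp
    also have "\<dots> = (\<Sum>i\<in>UNIV. a $ i * (\<Sum>j\<in>UNIV. b $ j *
        (\<Sum>k\<in>UNIV. c $ k * S (?e i) (?e j) (?e k) d)))"
      unfolding linear_cart_expansion[OF linear3, of _ _ c] by simp
    also have "\<dots> = (\<Sum>i\<in>UNIV. a $ i * (\<Sum>j\<in>UNIV. b $ j *
        (\<Sum>k\<in>UNIV. c $ k * (\<Sum>l\<in>UNIV. d $ l * s i j k l))))"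
      unfolding s_def linear_cart_expansion[OF linear4, of _ _ _ d] by simp
    finally
    show ?thesis by (simp add: sum_distrib_left mult.assoc)
  qed
  show ?thesis
  proof
    have s12: "s i j k l = s j i k l" and s34: "s i j k l = s i j l k"
      and sp: "s i j k l = s k l i j" for i j k l
      unfolding s_def by (rule S12, rule S34, rule pair)
    have "C a b c d = - C b a c d" for a b c d
      by (simp only: C_def minus_divide_left minus_diff_eq)
    moreover have "C a b c d = C c d a b" for a b c d
      unfolding C_def using s12[of c a d b] s34[of a c d b] s12[of d a c b] sp[of a d c b]
        s12[of c b a d] s34[of c b a d] s34[of b c a d] s34[of a d c b] by simp
    moreover have "C a b c d + C a c d b + C a d b c = 0" for a b c d
      unfolding C_def using sp[of d b a c] s34[of a c d b] sp[of a d c b] s12[of c b a d]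
        sp[of c d a b] s34[of a b c d]
      by (simp flip: add_divide_distrib)
    ultimately show "tensor_constants C"
      by (intro iffD2[OF tensor_constants_iff] conjI allI)
    show "Q x v w = (\<Sum>i\<in>UNIV. \<Sum>j\<in>UNIV. v $ i * w $ j * tensor_coeff C i j x)" for x v w
    proof -
      \<comment> \<open>The sums are reordered to \<open>i j k l\<close> so that both terms of
        \<open>C\<close> fall under one summation.\<close>
      have "S x w v x = (\<Sum>k\<in>UNIV. \<Sum>j\<in>UNIV. \<Sum>i\<in>UNIV. \<Sum>l\<in>UNIV. x $ k * w $ j * v $ i * x $ l * s k j i l)"
        by (rule expand)
      also have "\<dots> = (\<Sum>j\<in>UNIV. \<Sum>k\<in>UNIV. \<Sum>i\<in>UNIV. \<Sum>l\<in>UNIV. x $ k * w $ j * v $ i * x $ l * s k j i l)"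
        by (rule sum.swap)
      also have "\<dots> = (\<Sum>j\<in>UNIV. \<Sum>i\<in>UNIV. \<Sum>k\<in>UNIV. \<Sum>l\<in>UNIV. x $ k * w $ j * v $ i * x $ l * s k j i l)"
        by (intro sum.cong refl sum.swap)
      also have "\<dots> = (\<Sum>i\<in>UNIV. \<Sum>j\<in>UNIV. \<Sum>k\<in>UNIV. \<Sum>l\<in>UNIV. x $ k * w $ j * v $ i * x $ l * s k j i l)"
        by (rule sum.swap)
      finally have 2: "S x w v x = \<dots>" .
      have "(\<Sum>i\<in>UNIV. \<Sum>j\<in>UNIV. v $ i * w $ j * tensor_coeff C i j x) =
          (\<Sum>i\<in>UNIV. \<Sum>j\<in>UNIV. \<Sum>k\<in>UNIV. \<Sum>l\<in>UNIV.
            2 / 3 * (v $ i * w $ j * x $ k * x $ l * s i j k l - x $ k * w $ j * v $ i * x $ l * s k j i l))"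
        unfolding tensor_coeff_def C_def sum_distrib_left
        by (intro sum.cong refl) (simp add: field_simps)
      also have "\<dots> = 2 / 3 * (S v w x x - S x w v x)"
        unfolding 2 expand[of v]
        by (simp only: sum_subtractf sum_distrib_left right_diff_distrib)
      also have "\<dots> = Q x v w"
        using pair[of v w x x] diag[of x v w] mixed[of x w v] by simp
      finally show ?thesis by simp
    qed
  qed
qed

text \<open>Symmetry of the field lets one pass between the bilinear \<open>Q\<close> and its
  diagonal, the extended form, to which the exchange along great circles applies.\<close>

lemma constants_of_killing_tensor_field:
  fixes K :: "'n::finite ambient_field"
  assumes K: "killing_tensor_field 2 K"
  obtains C where "tensor_constants C"
    "\<And>U f u \<alpha> \<beta>. local_parametrization U f \<Longrightarrow> u \<in> U \<Longrightarrow> coord_components K f [\<alpha>, \<beta>] u =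
      (\<Sum>i\<in>UNIV. \<Sum>j\<in>UNIV. partial_deriv \<alpha> f u $ i * partial_deriv \<beta> f u $ j
        * tensor_coeff C i j (f u))"
proof -
  have tensor: "tensor_field 2 K" and symmetric: "symmetric_field 2 K"
    using K by (simp_all add: killing_tensor_field_def)
  define Q where "Q x v w = (norm x)\<^sup>2 * K (sgn x) [tangent_part x v, tangent_part x w]" for x v w
  have zero: "Q 0 v w = 0" for v w by (simp add: Q_def)
  have sym: "Q x v w = Q x w v" for x v w
  proof (cases "x = 0")
    case False
    have "Transposition.transpose 0 1 permutes {..<2::nat}"
      by (rule permutes_swap_id) auto
    then have "K (sgn x) (permute_list (Transposition.transpose 0 1) [tangent_part x v, tangent_part x w]) =
        K (sgn x) [tangent_part x v, tangent_part x w]"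
      using symmetric sgn_mem_sphere[OF False] unfolding symmetric_field_def
      by (simp add: tangent_part_mem)
    then show ?thesis by (simp add: Q_def permute_list_def upt_rec)
  qed (simp add: zero)
  have combination: "Q x (c *\<^sub>R v + d *\<^sub>R w) y = c * Q x v y + d * Q x w y" for x v w y c d
  proof (cases "x = 0")
    case False
    have "K (sgn x) ([0, tangent_part x y][0 := c *\<^sub>R tangent_part x v + d *\<^sub>R tangent_part x w]) =
        c * K (sgn x) ([0, tangent_part x y][0 := tangent_part x v])
        + d * K (sgn x) ([0, tangent_part x y][0 := tangent_part x w])"
      by (rule tensor_field_multilinear[OF tensor sgn_mem_sphere[OF False]])
        (simp_all add: tangent_part_mem, simp add: sphere_tangent_space_def)
    then show ?thesis
      by (simp add: Q_def linear_add[OF linear_tangent_part] linear_cmul[OF linear_tangent_part]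
          distrib_left mult.left_commute)
  qed (simp add: zero)
  have linear: "linear (\<lambda>v. Q x v w)" for x w
    using combination[of x 1 _ 1] combination[of x _ _ 0] by (intro linearI) simp_all
  have diag: "Q x v v = extended_form 2 K x v" for x v
    by (simp add: Q_def extended_form_def numeral_2_eq_2)
  have swap: "Q x v v = Q v x x" for x v
    using extended_form_swap[OF K, of v x] by (simp add: diag)
  have null: "Q x x w = 0" for x w
    using linear_0[OF linear[of x w]] by (simp add: Q_def)
  obtain C where "tensor_constants C"
    and expand: "\<And>x v w. Q x v w = (\<Sum>i\<in>UNIV. \<Sum>j\<in>UNIV. v $ i * w $ j * tensor_coeff C i j x)"
    using tensor_constants_of_biquadratic[of Q, OF linear sym swap null] by blast
  moreover have "coord_components K f [\<alpha>, \<beta>] u = Q (f u) (partial_deriv \<alpha> f u) (partial_deriv \<beta> f u)"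
    if "local_parametrization U f" "u \<in> U" for U f u \<alpha> \<beta>
    using param_point_extended[OF that] by (simp add: coord_components_def Q_def)
  ultimately show ?thesis
    using that by (simp only: expand)
qed

text \<open>Sufficiency asserts that a field with the given components exists, because a field is a
  function on ambient vectors while charts see only its values on tangent ones.\<close>

theorem proposition3p1:
  shows
    "(\<forall>B :: 'n::finite option \<Rightarrow> 'n option \<Rightarrow> real. vector_constants B \<longrightarrow>
        (\<exists>K. killing_vector_field K \<and>
          (\<forall>U f. local_parametrization U f \<longrightarrow> (\<forall>u\<in>U. \<forall>\<alpha>.
             coord_components K f [\<alpha>] u =
               (\<Sum>i\<in>UNIV. partial_deriv \<alpha> f u $ i * vector_coeff B i (f u)))))) \<and>
     (\<forall>K :: 'n ambient_field. killing_vector_field K \<longrightarrow>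
        (\<exists>B. vector_constants B \<and>
          (\<forall>U f. local_parametrization U f \<longrightarrow> (\<forall>u\<in>U. \<forall>\<alpha>.
             coord_components K f [\<alpha>] u =
               (\<Sum>i\<in>UNIV. partial_deriv \<alpha> f u $ i * vector_coeff B i (f u)))))) \<and>
     (\<forall>C :: 'n option \<Rightarrow> 'n option \<Rightarrow> 'n option \<Rightarrow> 'n option \<Rightarrow> real. tensor_constants C \<longrightarrow>
        (\<exists>K. killing_tensor_field 2 K \<and>
          (\<forall>U f. local_parametrization U f \<longrightarrow> (\<forall>u\<in>U. \<forall>\<alpha> \<beta>.
             coord_components K f [\<alpha>, \<beta>] u =
               (\<Sum>i\<in>UNIV. \<Sum>j\<in>UNIV. partial_deriv \<alpha> f u $ i * partial_deriv \<beta> f u $ j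
                  * tensor_coeff C i j (f u)))))) \<and>
     (\<forall>K :: 'n ambient_field. killing_tensor_field 2 K \<longrightarrow>
        (\<exists>C. tensor_constants C \<and>
          (\<forall>U f. local_parametrization U f \<longrightarrow> (\<forall>u\<in>U. \<forall>\<alpha> \<beta>.
             coord_components K f [\<alpha>, \<beta>] u =
               (\<Sum>i\<in>UNIV. \<Sum>j\<in>UNIV. partial_deriv \<alpha> f u $ i * partial_deriv \<beta> f u $ j
                  * tensor_coeff C i j (f u))))))"
  (is "?vector_suff \<and> ?vector_nec \<and> ?tensor_suff \<and> ?tensor_nec")
proof (intro conjI)
  show ?vector_suff
  proof (intro allI impI)
    fix B :: "'n option \<Rightarrow> 'n option \<Rightarrow> real" assume "vector_constants B"
    then obtain K where "killing_vector_field K"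
      "\<And>f u \<alpha>. coord_components K f [\<alpha>] u =
        (\<Sum>i\<in>UNIV. partial_deriv \<alpha> f u $ i * vector_coeff B i (f u))"
      using killing_vector_field_of_constants by blast
    then show "\<exists>K. killing_vector_field K \<and>
        (\<forall>U f. local_parametrization U f \<longrightarrow> (\<forall>u\<in>U. \<forall>\<alpha>. coord_components K f [\<alpha>] u =
          (\<Sum>i\<in>UNIV. partial_deriv \<alpha> f u $ i * vector_coeff B i (f u))))"
      by blast
  qed
  show ?vector_nec
  proof (intro allI impI)
    fix K :: "'n ambient_field" assume "killing_vector_field K"
    then obtain B where "vector_constants B"
      "\<And>U f u \<alpha>. local_parametrization U f \<Longrightarrow> u \<in> U \<Longrightarrow> coord_components K f [\<alpha>] u =
        (\<Sum>i\<in>UNIV. partial_deriv \<alpha> f u $ i * vector_coeff B i (f u))"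
      using constants_of_killing_vector_field by blast
    then show "\<exists>B. vector_constants B \<and>
        (\<forall>U f. local_parametrization U f \<longrightarrow> (\<forall>u\<in>U. \<forall>\<alpha>. coord_components K f [\<alpha>] u =
          (\<Sum>i\<in>UNIV. partial_deriv \<alpha> f u $ i * vector_coeff B i (f u))))"
      by blast
  qed
  show ?tensor_suff
  proof (intro allI impI)
    fix C :: "'n option \<Rightarrow> 'n option \<Rightarrow> 'n option \<Rightarrow> 'n option \<Rightarrow> real" assume "tensor_constants C"
    then obtain K where "killing_tensor_field 2 K"
      "\<And>f u \<alpha> \<beta>. coord_components K f [\<alpha>, \<beta>] u =
        (\<Sum>i\<in>UNIV. \<Sum>j\<in>UNIV. partial_deriv \<alpha> f u $ i * partial_deriv \<beta> f u $ j
          * tensor_coeff C i j (f u))"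
      using killing_tensor_field_of_constants by blast
    then show "\<exists>K. killing_tensor_field 2 K \<and>
        (\<forall>U f. local_parametrization U f \<longrightarrow> (\<forall>u\<in>U. \<forall>\<alpha> \<beta>. coord_components K f [\<alpha>, \<beta>] u =
          (\<Sum>i\<in>UNIV. \<Sum>j\<in>UNIV. partial_deriv \<alpha> f u $ i * partial_deriv \<beta> f u $ j
            * tensor_coeff C i j (f u))))"
      by blast
  qed
  show ?tensor_nec
  proof (intro allI impI)
    fix K :: "'n ambient_field" assume "killing_tensor_field 2 K"
    then obtain C where "tensor_constants C"
      "\<And>U f u \<alpha> \<beta>. local_parametrization U f \<Longrightarrow> u \<in> U \<Longrightarrow> coord_components K f [\<alpha>, \<beta>] u =
        (\<Sum>i\<in>UNIV. \<Sum>j\<in>UNIV. partial_deriv \<alpha> f u $ i * partial_deriv \<beta> f u $ j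
          * tensor_coeff C i j (f u))"
      using constants_of_killing_tensor_field by blast
    then show "\<exists>C. tensor_constants C \<and>
        (\<forall>U f. local_parametrization U f \<longrightarrow> (\<forall>u\<in>U. \<forall>\<alpha> \<beta>. coord_components K f [\<alpha>, \<beta>] u =
          (\<Sum>i\<in>UNIV. \<Sum>j\<in>UNIV. partial_deriv \<alpha> f u $ i * partial_deriv \<beta> f u $ j
            * tensor_coeff C i j (f u))))"
      by blast
  qed
qed

end
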